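(* For $n\ge 0$ let $f_n(x)=\sum_{k=0}^{n}f(n,k)x^k$ with $f(n,k)=\binom{n}{k}^2\binom{n+k}{k}$ be the Apéry polynomial, and let $$\mu_n=\frac{f_n'(1)}{f_n(1)},\qquad \sigma_n^2=\frac{f_n''(1)}{f_n(1)}+\mu_n-\mu_n^2 .$$ Then the coefficients $f(n,k)$ are asymptotically normal by local and central limit theorems with mean $\mu_n$ and variance $\sigma_n^2$, where, as $n\to\infty$, $$\mu_n\sim\frac{-1+\sqrt5}{2}\,n,\qquad \sigma_n^2\sim\frac{5-2\sqrt5}{5}\,n .$$
   Context: For nonnegative numbers $a(n,k)$ ($0\le k\le n$, and $a(n,k)=0$ for other $k$), let $p(n,k)=a(n,k)/\sum_{j=0}^n a(n,j)$. The numbers $a(n,k)$ are asymptotically normal with mean $\mu_n$ and variance $\sigma_n^2$ by a central limit theorem if $$\lim_{n\to\infty}\sup_{x\in\mathbb{R}}\Big|\sum_{k\le\mu_n+x\sigma_n}p(n,k)-\frac1{\sqrt{2\pi}}\int_{-\infty}^x e^{-t^2/2}\,dt\Big|=0,$$ and by a local limit theorem (on $\mathbb{R}$) if $$\lim_{n\to\infty}\sup_{x\in\mathbb{R}}\Big|\sigma_n\,p(n,\lfloor\mu_n+x\sigma_n\rfloor)-\frac1{\sqrt{2\pi}}e^{-x^2/2}\Big|=0.$$ Here $u_n\sim v_n$ means $u_n/v_n\to1$ as $n\to\infty$. *)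

theory Defs
  imports
    "HOL-Analysis.Analysis"
    "HOL-Computational_Algebra.Polynomial"
    "HOL-Library.Landau_Symbols"
begin

(* p(n,k) for an array a(n,k).  The second index is an integer because the local limit
   theorem evaluates p at floor(mu_n + x sigma_n), which may be negative; entries outside
   0 <= k <= n are zero. *)
definition normalized :: "(nat \<Rightarrow> nat \<Rightarrow> real) \<Rightarrow> nat \<Rightarrow> int \<Rightarrow> real" where
  "normalized a n k =
     (if 0 \<le> k \<and> k \<le> int n then a n (nat k) / (\<Sum>j=0..n. a n j) else 0)"

(* In the next two definitions v is the variance sigma_n^2, so sigma_n = sqrt (v n).
   For each n the functions of x are bounded, since normalized a n has finite support
   and the Gaussian terms are bounded; hence the real-valued SUP is the true supremum. *)
definition central_limit ::
    "(nat \<Rightarrow> nat \<Rightarrow> real) \<Rightarrow> (nat \<Rightarrow> real) \<Rightarrow> (nat \<Rightarrow> real) \<Rightarrow> bool" where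
  "central_limit a \<mu> v \<longleftrightarrow>
     (\<lambda>n. SUP x::real.
        \<bar>(\<Sum>k | 0 \<le> k \<and> k \<le> int n \<and> real_of_int k \<le> \<mu> n + x * sqrt (v n). normalized a n k)
          - 1 / sqrt (2 * pi) * (LINT t:{..x}|lborel. exp (- (t\<^sup>2 / 2)))\<bar>) \<longlonglongrightarrow> 0"

definition local_limit ::
    "(nat \<Rightarrow> nat \<Rightarrow> real) \<Rightarrow> (nat \<Rightarrow> real) \<Rightarrow> (nat \<Rightarrow> real) \<Rightarrow> bool" where
  "local_limit a \<mu> v \<longleftrightarrow>
     (\<lambda>n. SUP x::real.
        \<bar>sqrt (v n) * normalized a n \<lfloor>\<mu> n + x * sqrt (v n)\<rfloor>
          - 1 / sqrt (2 * pi) * exp (- (x\<^sup>2 / 2))\<bar>) \<longlonglongrightarrow> 0"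

definition apery_coeff :: "nat \<Rightarrow> nat \<Rightarrow> real" where
  "apery_coeff n k = real ((n choose k)\<^sup>2 * ((n + k) choose k))"

definition apery_poly :: "nat \<Rightarrow> real poly" where
  "apery_poly n = (\<Sum>k=0..n. monom (apery_coeff n k) k)"

definition apery_mean :: "nat \<Rightarrow> real" where
  "apery_mean n = poly (pderiv (apery_poly n)) 1 / poly (apery_poly n) 1"

definition apery_var :: "nat \<Rightarrow> real" where
  "apery_var n = poly (pderiv (pderiv (apery_poly n))) 1 / poly (apery_poly n) 1
                 + apery_mean n - (apery_mean n)\<^sup>2"

end

theory Submission
  imports Defs "HOL-Probability.Distributions" "HOL-Real_Asymp.Real_Asymp"
begin

text \<open>
  The ratio $f(n,k+1)/f(n,k) = (n-k)^2(n+k+1)/(k+1)^3$ is close to $1$ at the index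
  $m = \lfloor \kappa n \rfloor$, $\kappa = (\sqrt 5 - 1)/2$, because $(1-\kappa)^2(1+\kappa) = \kappa^3$.
  The slope of its logarithm is at most $-4/n$ everywhere and approximately $-1/(\tau n)$ near $m$.
  Telescoping gives $f(n,m+j) \le C e^{-2j^2/n} f(n,m)$ for all $j$ and
  $f(n,m+j)/f(n,m) \approx e^{-j^2/(2\tau n)}$ uniformly for $|j| \le M\sqrt n$.

  Sums over $k$ are integrals of step functions in $y = (k-m)/\sqrt n$, so dominated convergence
  evaluates the total mass and the first two moments: $\mu_n = m + o(\sqrt n)$ and
  $\sigma_n^2 \sim \tau n$. The local limit theorem follows because the Gaussian changes little under
  the resulting change of centre and scale. Dominated convergence upgrades it to $L^1$ convergence of
  the rescaled step densities, which bounds the distance of the distribution functions uniformly.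
\<close>

section \<open>Step functions and Gaussian integrals\<close>

text \<open>The integrand is constant on unit cells \<open>[k, k + 1)\<close>, and the affine
  substitution contributes the factor \<open>1 / w\<close>. This is the bridge between sums over
  \<open>k\<close> and integrals over the rescaled variable.\<close>

lemma has_bochner_integral_floor_step:
  fixes f :: "int \<Rightarrow> real"
  assumes S: "finite S" "\<And>k. k \<notin> S \<Longrightarrow> f k = 0" and w: "w > 0"
  shows "has_bochner_integral lborel (\<lambda>x. f \<lfloor>d + x * w\<rfloor>) ((\<Sum>k\<in>S. f k) / w)"
proof -
  have cell: "has_bochner_integral lborel (indicator {real_of_int k..<real_of_int k + 1}) (1::real)" for k
    using has_bochner_integral_real_indicator[of "{real_of_int k..<real_of_int k + 1}" lborel]
    by simp
  have "has_bochner_integral lborel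
          (\<lambda>x. \<Sum>k\<in>S. f k * indicator {real_of_int k..<real_of_int k + 1} x) (\<Sum>k\<in>S. f k * 1)"
    by (intro has_bochner_integral_sum has_bochner_integral_mult_right cell)
  moreover have "(\<Sum>k\<in>S. f k * indicator {real_of_int k..<real_of_int k + 1} x) = f \<lfloor>x\<rfloor>" for x
  proof -
    have "f k * indicator {real_of_int k..<real_of_int k + 1} x = (if k = \<lfloor>x\<rfloor> then f k else 0)" for k
    proof (cases "k = \<lfloor>x\<rfloor>")
      case False
      then have "x \<notin> {real_of_int k..<real_of_int k + 1}"
        using floor_unique[of k x] by (metis atLeastLessThan_iff)
      then show ?thesis using False by simp
    qed auto
    then show ?thesis
      using S by simp
  qed
  ultimately have "has_bochner_integral lborel (\<lambda>x::real. f \<lfloor>x\<rfloor>) (\<Sum>k\<in>S. f k)"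
    by simp
  then have "has_bochner_integral lborel (\<lambda>x. f \<lfloor>d + w * x\<rfloor>) ((\<Sum>k\<in>S. f k) /\<^sub>R \<bar>w\<bar>)"
    using w by (subst (asm) lborel_has_bochner_integral_real_affine_iff[of w _ _ d]) auto
  then show ?thesis
    using w by (simp add: mult.commute divide_inverse)
qed

text \<open>Shifting the sequence past the first good index reduces this to ordinary dominated
  convergence. The majorants below hold only for large \<open>n\<close>.\<close>

lemma integral_dominated_convergence_eventually:
  fixes f :: "'a \<Rightarrow> real"
  assumes "f \<in> borel_measurable M" "\<And>n. F n \<in> borel_measurable M" "integrable M w"
    and "\<And>x. (\<lambda>n. F n x) \<longlonglongrightarrow> f x"
    and "\<forall>\<^sub>F n in sequentially. \<forall>x. \<bar>F n x\<bar> \<le> w x"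
  shows "(\<lambda>n. integral\<^sup>L M (F n)) \<longlonglongrightarrow> integral\<^sup>L M f"
proof -
  obtain N where N: "\<And>n x. n \<ge> N \<Longrightarrow> \<bar>F n x\<bar> \<le> w x"
    using assms(5) by (auto simp: eventually_sequentially)
  show ?thesis
    by (rule LIMSEQ_offset[where k = N], rule integral_dominated_convergence[where w = w])
       (use assms N in \<open>auto intro!: AE_I2 LIMSEQ_ignore_initial_segment\<close>)
qed

section \<open>Gaussian moments, and stability of the Gaussian under shift and rescaling\<close>

lemma gaussian_as_normal_density:
  assumes "s > 0"
  shows "exp (- (x\<^sup>2 / (2 * s))) = sqrt (2 * pi * s) * normal_density 0 (sqrt s) x"
  using assms by (simp add: normal_density_def)

lemma integrable_gaussian:
  assumes "c > 0"
  shows "integrable lborel (\<lambda>x::real. exp (- c * x\<^sup>2))"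
  using gaussian_as_normal_density[of "1 / (2 * c)"] assms
  by (simp add: mult.commute)

lemma gaussian_moments:
  assumes "s > 0"
  shows "(LINT x|lborel. exp (- (x\<^sup>2 / (2 * s)))) = sqrt (2 * pi * s)"
    and "(LINT x|lborel. x * exp (- (x\<^sup>2 / (2 * s)))) = 0"
    and "(LINT x|lborel. x\<^sup>2 * exp (- (x\<^sup>2 / (2 * s)))) = s * sqrt (2 * pi * s)"
proof -
  show "(LINT x|lborel. exp (- (x\<^sup>2 / (2 * s)))) = sqrt (2 * pi * s)"
    using assms by (simp add: gaussian_as_normal_density)
  show "(LINT x|lborel. x * exp (- (x\<^sup>2 / (2 * s)))) = 0"
  proof -
    have "(LINT x|lborel. x * exp (- (x\<^sup>2 / (2 * s)))) =
        (LINT x|lborel. sqrt (2 * pi * s) * (normal_density 0 (sqrt s) x * x))"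
      using assms by (intro Bochner_Integration.integral_cong) (simp_all add: gaussian_as_normal_density)
    then show ?thesis
      using assms by (simp add: integral_normal_moment_nz_1)
  qed
  show "(LINT x|lborel. x\<^sup>2 * exp (- (x\<^sup>2 / (2 * s)))) = s * sqrt (2 * pi * s)"
  proof -
    have "(LINT x|lborel. x\<^sup>2 * exp (- (x\<^sup>2 / (2 * s)))) =
        (LINT x|lborel. sqrt (2 * pi * s) * (normal_density 0 (sqrt s) x * (x - 0) ^ (2 * 1)))"
      using assms by (intro Bochner_Integration.integral_cong) (simp_all add: gaussian_as_normal_density)
    then show ?thesis
      using assms integral_normal_moment_even[of "sqrt s" 0 1] by simp
  qed
qed

text \<open>The derivative is bounded by 1 because |z| <= 1 + z^2/2 <= exp(z^2/2). This controls a
  change of centre, including the rounding by the floor.\<close>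

lemma gaussian_lipschitz: "\<bar>exp (- (x\<^sup>2 / 2)) - exp (- (y\<^sup>2 / 2))\<bar> \<le> \<bar>x - y\<bar>" for x y :: real
proof -
  have "\<bar>z\<bar> * exp (- (z\<^sup>2 / 2)) \<le> 1" for z :: real
  proof -
    have "\<bar>z\<bar> \<le> 1 + z\<^sup>2 / 2"
      using zero_le_power2[of "\<bar>z\<bar> - 1"] by (simp add: power2_diff)
    also have "\<dots> \<le> exp (z\<^sup>2 / 2)"
      by (rule exp_ge_add_one_self)
    finally show ?thesis
      by (simp add: exp_minus field_simps)
  qed
  then have "norm (exp (- (x\<^sup>2 / 2)) - exp (- (y\<^sup>2 / 2))) \<le> 1 * norm (x - y)"
    by (intro field_differentiable_bound[of UNIV _ "\<lambda>z. - z * exp (- (z\<^sup>2 / 2))"])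
       (auto intro!: derivative_eq_intros simp: abs_mult)
  then show ?thesis by simp
qed

text \<open>The mean value theorem is applied in the variable q = r^2 with u = x^2/2 as a parameter.
  For q >= 1/2 the derivative -u exp(-u q) is at most 2 in absolute value whatever u is, so the
  bound is uniform in \<open>x\<close>.\<close>

lemma gaussian_rescale:
  fixes x r :: real
  assumes "1 / 2 \<le> r\<^sup>2"
  shows "\<bar>exp (- ((x * r)\<^sup>2 / 2)) - exp (- (x\<^sup>2 / 2))\<bar> \<le> 2 * \<bar>r\<^sup>2 - 1\<bar>"
proof -
  define u where "u = x\<^sup>2 / 2"
  have u: "u \<ge> 0" by (simp add: u_def)
  have "norm (exp (- (u * r\<^sup>2)) - exp (- (u * 1))) \<le> 2 * norm (r\<^sup>2 - 1)"
  proof (rule field_differentiable_bound[of "{1 / 2..}" _ "\<lambda>q. - u * exp (- (u * q))"])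
    fix q :: real assume "q \<in> {1 / 2..}"
    then have "1 / 2 \<le> q" by simp
    have "u / 2 \<le> u * q"
      using mult_left_mono[OF \<open>1 / 2 \<le> q\<close> u] by simp
    also have "1 + u * q \<le> exp (u * q)"
      by (rule exp_ge_add_one_self)
    finally have "u \<le> 2 * exp (u * q)" by linarith
    then show "norm (- u * exp (- (u * q))) \<le> 2"
      using u by (simp add: exp_minus field_simps)
  qed (use assms in \<open>auto intro!: derivative_eq_intros\<close>)
  then show ?thesis
    by (simp add: u_def power_mult_distrib mult.commute)
qed

section \<open>Suprema and floors in the limit\<close>

lemma sup_tendsto_zero:
  fixes h :: "nat \<Rightarrow> 'a \<Rightarrow> real"
  assumes "\<And>\<epsilon>. \<epsilon> > 0 \<Longrightarrow> \<forall>\<^sub>F n in sequentially. \<forall>x. \<bar>h n x\<bar> \<le> \<epsilon>"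
  shows "(\<lambda>n. SUP x. \<bar>h n x\<bar>) \<longlonglongrightarrow> 0"
proof (rule tendstoI)
  fix \<epsilon> :: real assume "\<epsilon> > 0"
  then have "\<forall>\<^sub>F n in sequentially. \<forall>x. \<bar>h n x\<bar> \<le> \<epsilon> / 2"
    by (intro assms) simp
  then show "\<forall>\<^sub>F n in sequentially. dist (SUP x. \<bar>h n x\<bar>) 0 < \<epsilon>"
  proof eventually_elim
    case (elim n)
    have "(SUP x. \<bar>h n x\<bar>) \<le> \<epsilon> / 2"
      using elim by (intro cSUP_least) auto
    moreover have "0 \<le> (SUP x. \<bar>h n x\<bar>)"
      \<comment> \<open>Any single point bounds the supremum from below by a nonnegative value;
        \<open>undefined\<close> merely names one. The bound \<epsilon>/2 supplies the boundedness
        that makes the real \<open>SUP\<close> meaningful.\<close>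
      using elim by (intro cSUP_upper2[where x = undefined] bdd_aboveI2[where M = "\<epsilon> / 2"]) auto
    ultimately show ?case
      using \<open>\<epsilon> > 0\<close> by simp
  qed
qed

lemma floor_scaled_tendsto: "(\<lambda>n. real_of_int \<lfloor>y * sqrt (real n)\<rfloor> / sqrt (real n)) \<longlonglongrightarrow> y"
proof -
  have "(\<lambda>n. real_of_int \<lfloor>y * sqrt (real n)\<rfloor> / sqrt (real n) - y) \<longlonglongrightarrow> 0"
  proof (rule Lim_null_comparison)
    show "(\<lambda>n. 1 / sqrt (real n)) \<longlonglongrightarrow> 0" by real_asymp
    show "\<forall>\<^sub>F n in sequentially. norm (real_of_int \<lfloor>y * sqrt (real n)\<rfloor> / sqrt (real n) - y) \<le> 1 / sqrt (real n)"
      using eventually_gt_at_top[of 0]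
    proof eventually_elim
      case (elim n)
      have "real_of_int \<lfloor>y * sqrt (real n)\<rfloor> / sqrt (real n) - y
          = (real_of_int \<lfloor>y * sqrt (real n)\<rfloor> - y * sqrt (real n)) / sqrt (real n)"
        using elim by (simp add: field_simps)
      then show ?case
        by (simp only: real_norm_def abs_divide abs_of_nonneg[OF real_sqrt_ge_zero[OF of_nat_0_le_iff]],
            intro divide_right_mono) (linarith, simp)
    qed
  qed
  then show ?thesis by (rule LIM_zero_cancel)
qed

text \<open>Follows from a^2 <= 2 b^2 + 2 (a - b)^2 with |a - b| <= 1. It turns Gaussian decay in
  the rounded variable into decay in the variable itself.\<close>

lemma floor_sq_ge: "(real_of_int \<lfloor>x\<rfloor>)\<^sup>2 \<ge> x\<^sup>2 / 2 - 1"
proof -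
  have "(x - real_of_int \<lfloor>x\<rfloor>)\<^sup>2 \<le> 1"
    by (rule power_le_one) linarith+
  moreover have "x\<^sup>2 \<le> 2 * (real_of_int \<lfloor>x\<rfloor>)\<^sup>2 + 2 * (x - real_of_int \<lfloor>x\<rfloor>)\<^sup>2"
    using zero_le_power2[of "x - 2 * real_of_int \<lfloor>x\<rfloor>"] by (simp add: power2_eq_square algebra_simps)
  ultimately show ?thesis by linarith
qed

section \<open>Arrays with a Gaussian profile\<close>

text \<open>Isolates the probabilistic argument from the estimates for a concrete array.
  \<open>near\<close> gives the Gaussian shape on windows of order sqrt n, \<open>dominated\<close>
  supplies the majorant for dominated convergence, and \<open>s\<close> becomes the limit of the
  variance divided by \<open>n\<close>. That the centre \<open>m\<close> lies within o(sqrt n) of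
  the mean is a consequence, not an assumption.\<close>

locale gaussian_profile =
  fixes p :: "nat \<Rightarrow> int \<Rightarrow> real" and m :: "nat \<Rightarrow> int" and s C c :: real
  assumes s_pos: "s > 0" and c_pos: "c > 0"
    and nonneg: "\<And>n k. p n k \<ge> 0"
    and support: "\<And>n k. k \<notin> {0..int n} \<Longrightarrow> p n k = 0"
    and total: "\<And>n. (\<Sum>k=0..int n. p n k) = 1"
    and centre_pos: "\<And>n. p n (m n) > 0"
    and near: "\<And>M \<epsilon>. \<epsilon> > 0 \<Longrightarrow> \<forall>\<^sub>F n in sequentially. \<forall>j. \<bar>real_of_int j\<bar> \<le> M * sqrt n \<longrightarrow>
        \<bar>p n (m n + j) / p n (m n) - exp (- ((real_of_int j)\<^sup>2 / (2 * s * n)))\<bar> \<le> \<epsilon>"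
    and dominated: "\<And>n j. n > 0 \<Longrightarrow> p n (m n + j) / p n (m n) \<le> C * exp (- c * (real_of_int j)\<^sup>2 / n)"
begin

definition profile :: "nat \<Rightarrow> int \<Rightarrow> real" where
  "profile n j = p n (m n + j) / p n (m n)"

definition \<mu> :: "nat \<Rightarrow> real" where
  "\<mu> n = (\<Sum>k=0..int n. real_of_int k * p n k)"

definition v :: "nat \<Rightarrow> real" where
  "v n = (\<Sum>k=0..int n. (real_of_int k)\<^sup>2 * p n k) - (\<mu> n)\<^sup>2"

lemma profile_nonneg: "profile n j \<ge> 0"
  by (simp add: profile_def nonneg)

lemma C_ge_1: "C \<ge> 1"
  using dominated[of 1 0] centre_pos[of 1] by simp

text \<open>For \<open>M\<close> large both the profile and the Gaussian are below \<epsilon>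
  outside the window |j| <= M sqrt n, so their difference is too; inside it, \<open>near\<close>
  applies.\<close>

lemma profile_uniform:
  assumes "\<epsilon> > 0"
  shows "\<forall>\<^sub>F n in sequentially. \<forall>j. \<bar>profile n j - exp (- ((real_of_int j)\<^sup>2 / (2 * s * n)))\<bar> \<le> \<epsilon>"
proof -
  have "((\<lambda>M. C * exp (- c * M\<^sup>2)) \<longlongrightarrow> 0) at_top" "((\<lambda>M. exp (- (1 / (2 * s)) * M\<^sup>2)) \<longlongrightarrow> 0) at_top"
    using c_pos s_pos by real_asymp+
  then have "\<forall>\<^sub>F M in at_top. C * exp (- c * M\<^sup>2) < \<epsilon> \<and> exp (- (1 / (2 * s)) * M\<^sup>2) < \<epsilon> \<and> M > 0"
    using assms by (intro eventually_conj order_tendstoD(2) eventually_gt_at_top) auto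
  then obtain M where M: "C * exp (- c * M\<^sup>2) < \<epsilon>" "exp (- (1 / (2 * s)) * M\<^sup>2) < \<epsilon>" "M > 0"
    by (auto dest: eventually_happens)
  show ?thesis
    using near[OF assms, of M] eventually_gt_at_top[of 0]
  proof eventually_elim
    case (elim n)
    show ?case
    proof
      fix j :: int
      let ?z = "real_of_int j"
      show "\<bar>profile n j - exp (- (?z\<^sup>2 / (2 * s * n)))\<bar> \<le> \<epsilon>"
      proof (cases "\<bar>?z\<bar> \<le> M * sqrt n")
        case True
        then show ?thesis using elim by (simp add: profile_def)
      next
        case False
        then have "(M * sqrt n)\<^sup>2 \<le> \<bar>?z\<bar>\<^sup>2"
          using M by (intro power_mono) auto
        then have z: "M\<^sup>2 \<le> ?z\<^sup>2 / n"
          using elim by (simp add: power_mult_distrib field_simps)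
        have "profile n j \<le> C * exp (- c * (?z\<^sup>2 / n))"
          using dominated[of n j] elim by (simp add: profile_def)
        also have "\<dots> \<le> C * exp (- c * M\<^sup>2)"
          using mult_left_mono[OF z, of c] c_pos C_ge_1 by simp
        finally have 1: "profile n j < \<epsilon>" using M by linarith
        have "exp (- (?z\<^sup>2 / (2 * s * n))) = exp (- (1 / (2 * s)) * (?z\<^sup>2 / n))"
          by simp
        also have "\<dots> \<le> exp (- (1 / (2 * s)) * M\<^sup>2)"
          using mult_left_mono[OF z, of "1 / (2 * s)"] s_pos by simp
        finally have 2: "exp (- (?z\<^sup>2 / (2 * s * n))) < \<epsilon>" using M by linarith
        have "0 < exp (- (?z\<^sup>2 / (2 * s * n)))" by simp
        then show ?thesis using 1 2 profile_nonneg[of n j] by linarith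
      qed
    qed
  qed
qed

text \<open>Uniformity in \<open>j\<close> permits an index that moves with \<open>n\<close>;
  continuity of the Gaussian then absorbs the rounding.\<close>

lemma profile_tendsto: "(\<lambda>n. profile n \<lfloor>y * sqrt (real n)\<rfloor>) \<longlonglongrightarrow> exp (- (y\<^sup>2 / (2 * s)))"
proof -
  let ?J = "\<lambda>n. real_of_int \<lfloor>y * sqrt (real n)\<rfloor>"
  have "(\<lambda>n. profile n \<lfloor>y * sqrt (real n)\<rfloor> - exp (- ((?J n)\<^sup>2 / (2 * s * n)))) \<longlonglongrightarrow> 0"
  proof (rule tendstoI)
    fix \<epsilon> :: real assume "\<epsilon> > 0"
    show "\<forall>\<^sub>F n in sequentially.
        dist (profile n \<lfloor>y * sqrt (real n)\<rfloor> - exp (- ((?J n)\<^sup>2 / (2 * s * n)))) 0 < \<epsilon>"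
      using profile_uniform[OF half_gt_zero[OF \<open>\<epsilon> > 0\<close>]]
    proof eventually_elim
      case (elim n)
      then have "\<bar>profile n \<lfloor>y * sqrt (real n)\<rfloor> - exp (- ((?J n)\<^sup>2 / (2 * s * n)))\<bar> \<le> \<epsilon> / 2"
        by blast
      with \<open>\<epsilon> > 0\<close> show ?case
        unfolding dist_real_def diff_0_right by linarith
    qed
  qed
  moreover have "(\<lambda>n. exp (- ((?J n / sqrt n)\<^sup>2 / (2 * s)))) \<longlonglongrightarrow> exp (- (y\<^sup>2 / (2 * s)))"
    using s_pos by (intro tendsto_intros floor_scaled_tendsto) auto
  then have "(\<lambda>n. exp (- ((?J n)\<^sup>2 / (2 * s * n)))) \<longlonglongrightarrow> exp (- (y\<^sup>2 / (2 * s)))"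
    by (simp add: power_divide mult_ac)
  ultimately show ?thesis
    using tendsto_add by fastforce
qed

section \<open>Moments about the centre and the limits of mean and variance\<close>

definition moment :: "nat \<Rightarrow> nat \<Rightarrow> real" where
  "moment r n = (\<Sum>k=0..int n. ((real_of_int k - m n) / sqrt n) ^ r * p n k)"

text \<open>Since \<open>m n\<close> is an integer, the floor of m + y sqrt n is \<open>m n\<close>
  plus the floor of y sqrt n, so the step function lemma applies with offset \<open>m n\<close> and
  scale \<open>sqrt n\<close>.\<close>

lemma moment_eq_integral:
  assumes "n > 0"
  shows "moment r n / (p n (m n) * sqrt n) =
    (LINT y|lborel. (real_of_int \<lfloor>y * sqrt n\<rfloor> / sqrt n) ^ r * profile n \<lfloor>y * sqrt n\<rfloor>)"
proof -
  have "has_bochner_integral lborel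
      (\<lambda>y. (\<lambda>k. ((real_of_int k - m n) / sqrt n) ^ r * p n k) \<lfloor>real_of_int (m n) + y * sqrt n\<rfloor>)
      (moment r n / sqrt n)"
    unfolding moment_def using assms by (intro has_bochner_integral_floor_step) (auto simp: support)
  from has_bochner_integral_divide_zero[OF this, of "p n (m n)"] show ?thesis
    by (simp add: has_bochner_integral_iff profile_def mult.commute)
qed

text \<open>Half of the decay exp(-c z^2) pays for the polynomial factor, as |z^r| <= 1 + z^2 <= (1
  + 2/c) exp(c z^2/2). The other half passes to \<open>y\<close> through z^2 >= y^2/2 - 1, which
  produces the constants \<open>exp (c / 2)\<close> and \<open>c / 4\<close>.\<close>

lemma moment_dominated:
  assumes "n > 0" "r \<le> 2"
  shows "\<bar>(real_of_int \<lfloor>y * sqrt n\<rfloor> / sqrt n) ^ r * profile n \<lfloor>y * sqrt n\<rfloor>\<bar>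
    \<le> (1 + 2 / c) * C * exp (c / 2) * exp (- (c / 4) * y\<^sup>2)"
proof -
  define z where "z = real_of_int \<lfloor>y * sqrt n\<rfloor> / sqrt n"
  have z2: "z\<^sup>2 = (real_of_int \<lfloor>y * sqrt n\<rfloor>)\<^sup>2 / n"
    by (simp add: z_def power_divide)
  have "1 / real n \<le> 1" using assms by simp
  moreover have "y\<^sup>2 / 2 - 1 / n \<le> z\<^sup>2"
    using divide_right_mono[OF floor_sq_ge[of "y * sqrt n"], of "real n"] assms
    by (simp add: z2 power_mult_distrib diff_divide_distrib)
  ultimately have zy: "y\<^sup>2 / 2 - 1 \<le> z\<^sup>2" by linarith
  have "\<bar>z ^ r\<bar> \<le> 1 + z\<^sup>2"
  proof -
    have "\<bar>z\<bar> \<le> 1 + z\<^sup>2"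
      using zero_le_power2[of "\<bar>z\<bar> - 1"] by (simp add: power2_diff)
    note bound = this
    consider "r = 0" | "r = 1" | "r = 2" using assms(2) by linarith
    then show ?thesis using bound by cases simp_all
  qed
  also have "z\<^sup>2 \<le> 2 / c * exp (c * z\<^sup>2 / 2)"
    using exp_ge_add_one_self[of "c * z\<^sup>2 / 2"] c_pos by (simp add: field_simps)
  also have "1 \<le> exp (c * z\<^sup>2 / 2)"
    using c_pos by simp
  finally have zr: "\<bar>z ^ r\<bar> \<le> (1 + 2 / c) * exp (c * z\<^sup>2 / 2)"
    by (simp add: distrib_right)
  have pr: "profile n \<lfloor>y * sqrt n\<rfloor> \<le> C * exp (- c * z\<^sup>2)"
    using dominated[OF assms(1), of "\<lfloor>y * sqrt n\<rfloor>"] by (simp add: profile_def z2)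
  have "\<bar>z ^ r * profile n \<lfloor>y * sqrt n\<rfloor>\<bar> = \<bar>z ^ r\<bar> * profile n \<lfloor>y * sqrt n\<rfloor>"
    using profile_nonneg by (simp add: abs_mult)
  also have "\<dots> \<le> ((1 + 2 / c) * exp (c * z\<^sup>2 / 2)) * (C * exp (- c * z\<^sup>2))"
    using c_pos by (intro mult_mono zr pr profile_nonneg) auto
  also have "\<dots> = (1 + 2 / c) * C * exp (- c * z\<^sup>2 / 2)"
    by (simp add: mult_exp_exp)
  also have "\<dots> \<le> (1 + 2 / c) * C * exp (c / 2 + - (c / 4) * y\<^sup>2)"
  proof -
    have "- c * z\<^sup>2 / 2 \<le> c / 2 + - (c / 4) * y\<^sup>2"
      using mult_left_mono[OF zy, of "c / 2"] c_pos by (simp add: algebra_simps)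
    then show ?thesis using c_pos C_ge_1 by (intro mult_left_mono) auto
  qed
  finally show ?thesis
    unfolding z_def exp_add by (simp only: mult.assoc)
qed

lemma moment_tendsto:
  assumes "r \<le> 2"
  shows "(\<lambda>n. moment r n / (p n (m n) * sqrt n)) \<longlonglongrightarrow> (LINT y|lborel. y ^ r * exp (- (y\<^sup>2 / (2 * s))))"
proof -
  have "(\<lambda>n. LINT y|lborel. (real_of_int \<lfloor>y * sqrt n\<rfloor> / sqrt n) ^ r * profile n \<lfloor>y * sqrt n\<rfloor>)
      \<longlonglongrightarrow> (LINT y|lborel. y ^ r * exp (- (y\<^sup>2 / (2 * s))))"
  proof (rule integral_dominated_convergence_eventually)
    show "integrable lborel (\<lambda>y. (1 + 2 / c) * C * exp (c / 2) * exp (- (c / 4) * y\<^sup>2))"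
      using c_pos by (intro integrable_mult_right integrable_gaussian) simp
    show "\<forall>\<^sub>F n in sequentially. \<forall>y. \<bar>(real_of_int \<lfloor>y * sqrt n\<rfloor> / sqrt n) ^ r * profile n \<lfloor>y * sqrt n\<rfloor>\<bar>
        \<le> (1 + 2 / c) * C * exp (c / 2) * exp (- (c / 4) * y\<^sup>2)"
      using eventually_gt_at_top[of 0] by eventually_elim (intro allI moment_dominated assms)
  qed (auto intro!: tendsto_intros floor_scaled_tendsto profile_tendsto)
  then show ?thesis
    by (rule Lim_transform_eventually)
       (use eventually_gt_at_top[of 0] in eventually_elim, simp add: moment_eq_integral)
qed

text \<open>The zeroth moment is the total mass 1, so its limit determines the height of the
  peak.\<close>

lemma peak_tendsto: "(\<lambda>n. p n (m n) * sqrt n) \<longlonglongrightarrow> 1 / sqrt (2 * pi * s)"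
proof -
  have "(\<lambda>n. 1 / (p n (m n) * sqrt n)) \<longlonglongrightarrow> sqrt (2 * pi * s)"
    using moment_tendsto[of 0] s_pos by (simp add: moment_def total gaussian_moments)
  then have "(\<lambda>n. 1 / (1 / (p n (m n) * sqrt n))) \<longlonglongrightarrow> 1 / sqrt (2 * pi * s)"
    using s_pos by (intro tendsto_divide) auto
  then show ?thesis by simp
qed

lemma moment_limits: "moment 1 \<longlonglongrightarrow> 0" "moment 2 \<longlonglongrightarrow> s"
proof -
  have mult: "(\<lambda>n. moment r n / (p n (m n) * sqrt n) * (p n (m n) * sqrt n))
      \<longlonglongrightarrow> (LINT y|lborel. y ^ r * exp (- (y\<^sup>2 / (2 * s)))) * (1 / sqrt (2 * pi * s))" if "r \<le> 2" for r
    by (intro tendsto_mult peak_tendsto moment_tendsto that)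
  have cancel: "\<forall>\<^sub>F n in sequentially.
      moment r n / (p n (m n) * sqrt n) * (p n (m n) * sqrt n) = moment r n" for r
    using eventually_gt_at_top[of 0]
  proof eventually_elim
    case (elim n)
    then show ?case using centre_pos[of n] by simp
  qed
  show "moment 1 \<longlonglongrightarrow> 0"
    using Lim_transform_eventually[OF mult cancel, of 1] s_pos by (simp add: gaussian_moments)
  show "moment 2 \<longlonglongrightarrow> s"
    using Lim_transform_eventually[OF mult cancel, of 2] s_pos by (simp add: gaussian_moments)
qed

text \<open>Centring \<open>moment\<close> at \<open>m n\<close> instead of the mean makes the first
  moment measure exactly the distance between the two.\<close>

lemma mean_eq: "n > 0 \<Longrightarrow> (\<mu> n - m n) / sqrt n = moment 1 n"
  using total[of n]
  by (simp add: \<mu>_def moment_def sum_subtractf diff_divide_distrib left_diff_distrib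
      flip: sum_divide_distrib sum_distrib_left)

text \<open>The parallel axis identity: the second moment about \<open>m n\<close> exceeds the
  variance by the squared distance from the mean to \<open>m n\<close>.\<close>

lemma var_eq:
  assumes "n > 0"
  shows "v n / n = moment 2 n - (moment 1 n)\<^sup>2"
proof -
  define a where "a = real_of_int (m n)"
  have "n * moment 2 n = (\<Sum>k=0..int n. (real_of_int k - a)\<^sup>2 * p n k)"
    using assms by (simp add: moment_def a_def sum_distrib_left power_divide)
  also have "\<dots> = (\<Sum>k=0..int n. (real_of_int k)\<^sup>2 * p n k - 2 * a * (real_of_int k * p n k) + a\<^sup>2 * p n k)"
    by (intro sum.cong) (auto simp: power2_diff algebra_simps)
  also have "\<dots> = v n + (\<mu> n)\<^sup>2 - 2 * a * \<mu> n + a\<^sup>2"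
    using total[of n] by (simp add: v_def \<mu>_def sum.distrib sum_subtractf flip: sum_distrib_left)
  also have "\<dots> = v n + n * (moment 1 n)\<^sup>2"
    using assms by (simp only: mean_eq[OF assms, symmetric]) (simp add: a_def power2_diff power_divide)
  finally show ?thesis
    using assms by (simp add: field_simps)
qed

lemma mean_centre_tendsto: "(\<lambda>n. (\<mu> n - m n) / sqrt n) \<longlonglongrightarrow> 0"
  by (rule Lim_transform_eventually[OF moment_limits(1)])
     (use eventually_gt_at_top[of 0] in eventually_elim, simp add: mean_eq)

lemma var_tendsto: "(\<lambda>n. v n / n) \<longlonglongrightarrow> s"
proof -
  have "(\<lambda>n. moment 2 n - (moment 1 n)\<^sup>2) \<longlonglongrightarrow> s - 0\<^sup>2"
    by (intro tendsto_intros moment_limits)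
  moreover have "\<forall>\<^sub>F n in sequentially. moment 2 n - (moment 1 n)\<^sup>2 = v n / n"
    using eventually_gt_at_top[of 0] by eventually_elim (simp only: var_eq)
  ultimately show ?thesis
    by (auto dest: Lim_transform_eventually)
qed

lemma sd_ratio_tendsto: "(\<lambda>n. sqrt (v n) / sqrt n) \<longlonglongrightarrow> sqrt s"
  using tendsto_real_sqrt[OF var_tendsto] by (simp add: real_sqrt_divide)

lemma sd_peak_tendsto: "(\<lambda>n. sqrt (v n) * p n (m n)) \<longlonglongrightarrow> 1 / sqrt (2 * pi)"
proof -
  have "(\<lambda>n. sqrt (v n) / sqrt n * (p n (m n) * sqrt n)) \<longlonglongrightarrow> sqrt s * (1 / sqrt (2 * pi * s))"
    by (intro tendsto_mult sd_ratio_tendsto peak_tendsto)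
  moreover have "\<forall>\<^sub>F n in sequentially. sqrt (v n) / sqrt n * (p n (m n) * sqrt n) = sqrt (v n) * p n (m n)"
    using eventually_gt_at_top[of 0] by eventually_elim simp
  ultimately show ?thesis
    using s_pos by (auto simp: real_sqrt_mult dest: Lim_transform_eventually)
qed

lemma var_pos: "\<forall>\<^sub>F n in sequentially. v n > 0"
proof -
  have "\<forall>\<^sub>F n in sequentially. v n / n > 0"
    using var_tendsto s_pos by (rule order_tendstoD)
  with eventually_gt_at_top[of 0] show ?thesis
    by eventually_elim (simp add: zero_less_divide_iff)
qed

lemma sd_filterlim: "filterlim (\<lambda>n. sqrt (v n)) at_top sequentially"
proof -
  have "filterlim (\<lambda>n. sqrt (v n) / sqrt n * sqrt n) at_top sequentially"
    using s_pos by (intro filterlim_tendsto_pos_mult_at_top[OF sd_ratio_tendsto]) (auto, real_asymp)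
  then show ?thesis
    by (rule filterlim_cong[THEN iffD1, OF refl refl, rotated])
       (use eventually_gt_at_top[of 0] in \<open>eventually_elim, simp\<close>)
qed

section \<open>The local limit theorem, uniformly in \<open>x\<close>\<close>

definition offset :: "nat \<Rightarrow> real \<Rightarrow> int" where
  "offset n x = \<lfloor>\<mu> n + x * sqrt (v n)\<rfloor> - m n"

lemma offset_error: "\<bar>real_of_int (offset n x) - x * sqrt (v n)\<bar> \<le> \<bar>\<mu> n - m n\<bar> + 1"
  unfolding offset_def by linarith

lemma scaled_eq: "sqrt (v n) * p n \<lfloor>\<mu> n + x * sqrt (v n)\<rfloor> = sqrt (v n) * p n (m n) * profile n (offset n x)"
  using centre_pos[of n] by (simp add: profile_def offset_def)

text \<open>Four errors are added: profile against Gaussian at the rescaled offset \<open>a\<close>,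
  displacement of \<open>a\<close> from x r (bounded by \<open>d\<close>), the scale
  \<open>r\<close> tending to 1, and the prefactor \<open>K\<close> tending to the Gaussian peak
  height.\<close>

lemma local_uniform:
  assumes "\<epsilon> > 0"
  shows "\<forall>\<^sub>F n in sequentially. \<forall>x.
    \<bar>sqrt (v n) * p n \<lfloor>\<mu> n + x * sqrt (v n)\<rfloor> - 1 / sqrt (2 * pi) * exp (- (x\<^sup>2 / 2))\<bar> \<le> \<epsilon>"
proof -
  define K where "K = (\<lambda>n. sqrt (v n) * p n (m n))"
  \<comment> \<open>Here \<kappa> is only the peak height of the standard Gaussian, not the constant
    defined later for the Apery coefficients.\<close>
  define \<kappa> where "\<kappa> = 1 / sqrt (2 * pi)"
  define r where "r = (\<lambda>n. sqrt (v n) / sqrt (s * n))"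
  define d where "d = (\<lambda>n. (\<bar>\<mu> n - m n\<bar> + 1) / sqrt (s * n))"
  \<comment> \<open>A limit strictly below 1 gives K n < 1 eventually, so multiplication by
    \<open>K n\<close> does not enlarge the errors.\<close>
  have "sqrt 1 < sqrt (2 * pi)"
    using pi_gt3 by (intro real_sqrt_less_mono) linarith
  then have "\<kappa> < 1"
    by (simp add: \<kappa>_def)
  have "r \<longlonglongrightarrow> sqrt s / sqrt s"
    unfolding r_def real_sqrt_mult using s_pos tendsto_divide[OF sd_ratio_tendsto tendsto_const[of "sqrt s"]]
    by (simp add: mult.commute)
  then have "(\<lambda>n. (r n)\<^sup>2 - 1) \<longlonglongrightarrow> (sqrt s / sqrt s)\<^sup>2 - 1"
    by (intro tendsto_intros)
  then have r_lim: "(\<lambda>n. \<bar>(r n)\<^sup>2 - 1\<bar>) \<longlonglongrightarrow> 0"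
    using s_pos by (intro tendsto_rabs_zero) simp
  have "(\<lambda>n. (\<bar>(\<mu> n - m n) / sqrt n\<bar> + 1 / sqrt n) / sqrt s) \<longlonglongrightarrow> (\<bar>0\<bar> + 0) / sqrt s"
    using s_pos by (intro tendsto_intros mean_centre_tendsto) (auto, real_asymp)
  then have d_lim: "d \<longlonglongrightarrow> 0"
    by (simp add: d_def real_sqrt_mult add_divide_distrib mult.commute)
  have K_lim: "K \<longlonglongrightarrow> \<kappa>"
    using sd_peak_tendsto by (simp add: K_def \<kappa>_def)
  \<comment> \<open>Each of the four errors receives \<epsilon>/4. The scale error gets \<epsilon>/8
    because \<open>gaussian_rescale\<close> doubles it, and the cap 1/2 secures its hypothesis on
    r^2.\<close>
  have ev: "\<forall>\<^sub>F n in sequentially. K n < 1" "\<forall>\<^sub>F n in sequentially. \<bar>K n - \<kappa>\<bar> < \<epsilon> / 4"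
    "\<forall>\<^sub>F n in sequentially. d n < \<epsilon> / 4" "\<forall>\<^sub>F n in sequentially. \<bar>(r n)\<^sup>2 - 1\<bar> < min (\<epsilon> / 8) (1 / 2)"
    subgoal using K_lim \<open>\<kappa> < 1\<close> by (rule order_tendstoD)
    subgoal using tendstoD[OF K_lim, of "\<epsilon> / 4"] assms by (simp add: dist_real_def)
    subgoal using d_lim assms by (intro order_tendstoD(2)[where a = "\<epsilon> / 4"]) auto
    subgoal using r_lim assms by (intro order_tendstoD(2)[where y = 0]) auto
    done
  have "\<epsilon> / 4 > 0" using assms by simp
  from ev profile_uniform[OF this] eventually_gt_at_top[of 0] var_pos show ?thesis
  proof eventually_elim
    case (elim n)
    have K_nonneg: "K n \<ge> 0"
      using nonneg[of n "m n"] elim by (simp add: K_def)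
    show ?case
    proof
      fix x :: real
      define a where "a = real_of_int (offset n x) / sqrt (s * n)"
      have sn: "s * n > 0" using s_pos elim by simp
      have "(real_of_int (offset n x))\<^sup>2 / (2 * s * n) = a\<^sup>2 / 2"
        using sn by (simp add: a_def power_divide)
      then have 1: "\<bar>profile n (offset n x) - exp (- (a\<^sup>2 / 2))\<bar> \<le> \<epsilon> / 4"
        using elim(5) by metis
      have "\<bar>a - x * r n\<bar> = \<bar>real_of_int (offset n x) - x * sqrt (v n)\<bar> / sqrt (s * n)"
        using sn by (simp add: a_def r_def abs_divide flip: diff_divide_distrib)
      also have "\<dots> \<le> d n"
        unfolding d_def using sn by (intro divide_right_mono offset_error) auto
      finally have 2: "\<bar>exp (- (a\<^sup>2 / 2)) - exp (- ((x * r n)\<^sup>2 / 2))\<bar> \<le> \<epsilon> / 4"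
        using gaussian_lipschitz[of a "x * r n"] elim(3) by linarith
      have "1 / 2 \<le> (r n)\<^sup>2"
        using elim(4) by linarith
      from gaussian_rescale[OF this, of x]
      have 3: "\<bar>exp (- ((x * r n)\<^sup>2 / 2)) - exp (- (x\<^sup>2 / 2))\<bar> \<le> \<epsilon> / 4"
        using elim(4) by auto
      define e where "e = exp (- (x\<^sup>2 / 2))"
      have e: "0 \<le> e" "e \<le> 1" by (auto simp: e_def)
      have "\<bar>profile n (offset n x) - e\<bar> \<le> 3 * \<epsilon> / 4"
        using 1 2 3 unfolding e_def by linarith
      then have "K n * \<bar>profile n (offset n x) - e\<bar> \<le> 1 * (3 * \<epsilon> / 4)"
        using K_nonneg elim(1) by (intro mult_mono) auto
      moreover have "\<bar>K n - \<kappa>\<bar> * e \<le> \<epsilon> / 4 * 1"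
        using elim(2) e assms by (intro mult_mono) auto
      moreover have "K n * profile n (offset n x) - \<kappa> * e
          = K n * (profile n (offset n x) - e) + (K n - \<kappa>) * e"
        by (simp add: algebra_simps)
      then have "\<bar>K n * profile n (offset n x) - \<kappa> * e\<bar>
          \<le> K n * \<bar>profile n (offset n x) - e\<bar> + \<bar>K n - \<kappa>\<bar> * e"
        using abs_triangle_ineq[of "K n * (profile n (offset n x) - e)" "(K n - \<kappa>) * e"] K_nonneg e
        by (simp add: abs_mult)
      ultimately have "\<bar>K n * profile n (offset n x) - \<kappa> * e\<bar> \<le> \<epsilon>"
        by linarith
      then show "\<bar>sqrt (v n) * p n \<lfloor>\<mu> n + x * sqrt (v n)\<rfloor> - 1 / sqrt (2 * pi) * exp (- (x\<^sup>2 / 2))\<bar> \<le> \<epsilon>"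
        by (simp only: scaled_eq K_def \<kappa>_def e_def)
    qed
  qed
qed

section \<open>From local convergence to convergence of distribution functions\<close>

lemma scaled_integrable:
  assumes "v n > 0"
  shows "integrable lborel (\<lambda>x. sqrt (v n) * p n \<lfloor>\<mu> n + x * sqrt (v n)\<rfloor>)"
  using has_bochner_integral_floor_step[of "{0..int n}" "p n" "sqrt (v n)" "\<mu> n"] assms support
  by (auto simp: has_bochner_integral_iff)

text \<open>Centre and floor move the index by at most sqrt n, so j^2/n >= (x^2/2) (v/n) - 1.
  Eventually v/n > s/2, which turns the tail bound in \<open>j\<close> into one in \<open>x\<close>
  that is independent of \<open>n\<close>.\<close>

lemma scaled_dominated:
  "\<forall>\<^sub>F n in sequentially. \<forall>x. sqrt (v n) * p n \<lfloor>\<mu> n + x * sqrt (v n)\<rfloor> \<le> C * exp c * exp (- (c * s / 4) * x\<^sup>2)"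
proof -
  have "sqrt 1 < sqrt (2 * pi)"
    using pi_gt3 by (intro real_sqrt_less_mono) linarith
  then have "1 / sqrt (2 * pi) < 1"
    by simp
  then have 1: "\<forall>\<^sub>F n in sequentially. sqrt (v n) * p n (m n) < 1"
    by (rule order_tendstoD[OF sd_peak_tendsto])
  have "(\<lambda>n. \<bar>(\<mu> n - m n) / sqrt n\<bar> + 1 / sqrt n) \<longlonglongrightarrow> \<bar>0\<bar> + 0"
    by (intro tendsto_intros mean_centre_tendsto) real_asymp
  then have 2: "\<forall>\<^sub>F n in sequentially. \<bar>(\<mu> n - m n) / sqrt n\<bar> + 1 / sqrt n < 1"
    by (rule order_tendstoD) simp
  have 3: "\<forall>\<^sub>F n in sequentially. v n / n > s / 2"
    using s_pos by (intro order_tendstoD[OF var_tendsto]) simp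
  from 1 2 3 eventually_gt_at_top[of 0] var_pos show ?thesis
  proof eventually_elim
    case (elim n)
    show ?case
    proof
      fix x :: real
      define j where "j = real_of_int (offset n x)"
      define y where "y = x * sqrt (v n)"
      have "\<bar>\<mu> n - m n\<bar> + 1 \<le> sqrt n"
        using elim(2,4) by (simp add: field_simps)
      then have "\<bar>j - y\<bar> \<le> sqrt n"
        using offset_error[of n x] unfolding j_def y_def by linarith
      then have "(j - y)\<^sup>2 \<le> n"
        using power_mono[of "\<bar>j - y\<bar>" "sqrt n" 2] by simp
      moreover have "y\<^sup>2 \<le> 2 * j\<^sup>2 + 2 * (j - y)\<^sup>2"
        using zero_le_power2[of "2 * j - y"] by (simp add: power2_eq_square algebra_simps)
      ultimately have "y\<^sup>2 / 2 - n \<le> j\<^sup>2"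
        by linarith
      then have "(y\<^sup>2 / 2 - n) / n \<le> j\<^sup>2 / n"
        by (intro divide_right_mono) auto
      then have "x\<^sup>2 / 2 * (v n / n) - 1 \<le> j\<^sup>2 / n"
        using elim(4,5) by (simp add: y_def power_mult_distrib diff_divide_distrib)
      moreover have "x\<^sup>2 / 2 * (s / 2) \<le> x\<^sup>2 / 2 * (v n / n)"
        using elim(3) by (intro mult_left_mono) auto
      ultimately have "x\<^sup>2 * s / 4 - 1 \<le> j\<^sup>2 / n"
        by linarith
      then have "c * (x\<^sup>2 * s / 4 - 1) \<le> c * (j\<^sup>2 / n)"
        using c_pos by (intro mult_left_mono) auto
      then have le: "- c * j\<^sup>2 / n \<le> c + - (c * s / 4) * x\<^sup>2"
        by (simp add: algebra_simps)
      have "sqrt (v n) * p n (m n) * profile n (offset n x) \<le> 1 * profile n (offset n x)"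
        using elim(1) profile_nonneg by (intro mult_right_mono) auto
      also have "\<dots> \<le> C * exp (- c * j\<^sup>2 / n)"
        using dominated[OF elim(4), of "offset n x"] by (simp add: profile_def j_def)
      also have "\<dots> \<le> C * exp (c + - (c * s / 4) * x\<^sup>2)"
        using le C_ge_1 by (intro mult_left_mono) auto
      finally show "sqrt (v n) * p n \<lfloor>\<mu> n + x * sqrt (v n)\<rfloor> \<le> C * exp c * exp (- (c * s / 4) * x\<^sup>2)"
        unfolding scaled_eq exp_add by (simp only: mult.assoc)
    qed
  qed
qed

text \<open>Uniform closeness does not by itself control integrals over half-lines; the common
  Gaussian majorant does.\<close>

lemma scaled_L1_tendsto:
  "(\<lambda>n. LINT x|lborel. \<bar>sqrt (v n) * p n \<lfloor>\<mu> n + x * sqrt (v n)\<rfloor> - 1 / sqrt (2 * pi) * exp (- (x\<^sup>2 / 2))\<bar>)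
    \<longlonglongrightarrow> 0"
proof -
  let ?h = "\<lambda>n x. sqrt (v n) * p n \<lfloor>\<mu> n + x * sqrt (v n)\<rfloor>"
  let ?\<phi> = "\<lambda>x. 1 / sqrt (2 * pi) * exp (- (x\<^sup>2 / 2))"
  let ?w = "\<lambda>x. C * exp c * exp (- (c * s / 4) * x\<^sup>2) + 1 / sqrt (2 * pi) * exp (- (1 / 2) * x\<^sup>2)"
  have "(\<lambda>n. LINT x|lborel. \<bar>?h n x - ?\<phi> x\<bar>) \<longlonglongrightarrow> (LINT x::real|lborel. (0::real))"
  proof (rule integral_dominated_convergence_eventually)
    show "integrable lborel ?w"
      using s_pos c_pos
      by (intro Bochner_Integration.integrable_add integrable_mult_right integrable_gaussian) auto
    show "(\<lambda>n. \<bar>?h n x - ?\<phi> x\<bar>) \<longlonglongrightarrow> 0" for x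
    proof (intro tendsto_rabs_zero tendstoI)
      fix \<epsilon> :: real assume "\<epsilon> > 0"
      from local_uniform[OF half_gt_zero[OF this]]
      show "\<forall>\<^sub>F n in sequentially. dist (?h n x - ?\<phi> x) 0 < \<epsilon>"
      proof eventually_elim
        case (elim n)
        then have "\<bar>?h n x - ?\<phi> x\<bar> \<le> \<epsilon> / 2" by blast
        with \<open>\<epsilon> > 0\<close> show ?case
          unfolding dist_real_def diff_0_right by linarith
      qed
    qed
    from scaled_dominated eventually_gt_at_top[of 0] var_pos
    show "\<forall>\<^sub>F n in sequentially. \<forall>x. \<bar>\<bar>?h n x - ?\<phi> x\<bar>\<bar> \<le> ?w x"
    proof eventually_elim
      case (elim n)
      show ?case
      proof
        fix x :: real
        have "0 \<le> ?h n x" using elim nonneg[of n] by simp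
        moreover have "?h n x \<le> C * exp c * exp (- (c * s / 4) * x\<^sup>2)" using elim by blast
        moreover have "0 \<le> ?\<phi> x" by simp
        moreover have "?\<phi> x = 1 / sqrt (2 * pi) * exp (- (1 / 2) * x\<^sup>2)" by simp
        ultimately show "\<bar>\<bar>?h n x - ?\<phi> x\<bar>\<bar> \<le> ?w x" by linarith
      qed
    qed
  qed measurable
  then show ?thesis by simp
qed

text \<open>The partial sum is the integral of the step density over a set \<open>B\<close> lying
  between {..x} and {..x + 1/sqrt (v n)}. The error is therefore at most the L1 distance plus the
  length of one cell, and neither depends on \<open>x\<close>.\<close>

lemma cdf_uniform:
  assumes "\<epsilon> > 0"
  shows "\<forall>\<^sub>F n in sequentially. \<forall>x.
    \<bar>(\<Sum>k | 0 \<le> k \<and> k \<le> int n \<and> real_of_int k \<le> \<mu> n + x * sqrt (v n). p n k)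
      - 1 / sqrt (2 * pi) * (LINT t:{..x}|lborel. exp (- (t\<^sup>2 / 2)))\<bar> \<le> \<epsilon>"
proof -
  let ?h = "\<lambda>n x. sqrt (v n) * p n \<lfloor>\<mu> n + x * sqrt (v n)\<rfloor>"
  let ?\<phi> = "\<lambda>x. 1 / sqrt (2 * pi) * exp (- (x\<^sup>2 / 2))"
  have \<phi>_int: "integrable lborel ?\<phi>"
    using integrable_gaussian[of "1 / 2"] by simp
  have "\<epsilon> / 2 > 0" using assms by simp
  have ev: "\<forall>\<^sub>F n in sequentially. (LINT x|lborel. \<bar>?h n x - ?\<phi> x\<bar>) < \<epsilon> / 2"
    using scaled_L1_tendsto \<open>\<epsilon> / 2 > 0\<close> by (rule order_tendstoD)
  have "\<forall>\<^sub>F n in sequentially. sqrt (v n) > max 0 (2 / \<epsilon>)"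
    using sd_filterlim by (simp only: filterlim_at_top_dense)
  with ev show ?thesis
  proof eventually_elim
    case (elim n)
    then have v: "v n > 0" by simp
    let ?w = "sqrt (v n)"
    have w: "?w > 0" using v by simp
    have w_small: "1 / ?w \<le> \<epsilon> / 2"
      using elim(2) assms v by (simp add: field_simps)
    show ?case
    proof
      fix x :: real
      define S where "S = {k. 0 \<le> k \<and> k \<le> int n \<and> real_of_int k \<le> \<mu> n + x * ?w}"
      define B where "B = {y. real_of_int \<lfloor>\<mu> n + y * ?w\<rfloor> \<le> \<mu> n + x * ?w}"
      \<comment> \<open>The cutoff is built into the summand, so that composing with the floor
        yields the step density restricted to \<open>B\<close>.\<close>
      define f where "f = (\<lambda>k::int. if real_of_int k \<le> \<mu> n + x * ?w then p n k else 0)"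
      have "S \<subseteq> {0..int n}" by (auto simp: S_def)
      then have "finite S" by (rule finite_subset) simp
      then have "has_bochner_integral lborel (\<lambda>y. f \<lfloor>\<mu> n + y * ?w\<rfloor>) ((\<Sum>k\<in>S. f k) / ?w)"
        using support[of _ n] v by (intro has_bochner_integral_floor_step) (auto simp: S_def f_def)
      from has_bochner_integral_mult_right[OF this, of ?w]
      have "has_bochner_integral lborel (\<lambda>y. ?w * f \<lfloor>\<mu> n + y * ?w\<rfloor>) (\<Sum>k\<in>S. f k)"
        using v by simp
      moreover have "(\<Sum>k\<in>S. f k) = (\<Sum>k\<in>S. p n k)"
        by (intro sum.cong) (auto simp: S_def f_def)
      moreover have "?w * f \<lfloor>\<mu> n + y * ?w\<rfloor> = indicator B y * ?h n y" for y
        by (auto simp: f_def B_def)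
      ultimately have hB: "has_bochner_integral lborel (\<lambda>y. indicator B y * ?h n y) (\<Sum>k\<in>S. p n k)"
        by simp
      have \<phi>A: "integrable lborel (\<lambda>y. indicator {..x} y * ?\<phi> y)"
        using integrable_mult_indicator[OF _ \<phi>_int, of "{..x}"] by simp
      have gap_int: "has_bochner_integral lborel (indicator {x..x + 1 / ?w}) (1 / ?w)"
        using has_bochner_integral_real_indicator[of "{x..x + 1 / ?w}" lborel] w by simp
      have diff_int: "integrable lborel (\<lambda>y. \<bar>?h n y - ?\<phi> y\<bar>)"
        by (intro integrable_abs Bochner_Integration.integrable_diff scaled_integrable v \<phi>_int)
      have gap: "\<bar>indicator B y * ?h n y - indicator {..x} y * ?\<phi> y\<bar>
          \<le> \<bar>?h n y - ?\<phi> y\<bar> + indicator {x..x + 1 / ?w} y" for y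
      proof -
        have "?\<phi> y \<le> 1 * 1"
          using pi_gt3 by (intro mult_mono) (auto intro!: real_le_rsqrt)
        moreover have "0 \<le> ?\<phi> y" by simp
        moreover have "y \<in> B" if "y \<le> x"
        proof -
          have "y * ?w \<le> x * ?w" using that w by (intro mult_right_mono) auto
          then show ?thesis unfolding B_def by (auto intro: order_trans[OF of_int_floor_le])
        qed
        moreover have "y \<le> x + 1 / ?w" if "y \<in> B"
        proof -
          have "y * ?w \<le> x * ?w + 1" using that unfolding B_def mem_Collect_eq by linarith
          then show ?thesis using w by (simp add: field_simps)
        qed
        \<comment> \<open>Only x < y with \<open>y\<close> in \<open>B\<close> is delicate: there
          |a| <= |a - b| + b, and b <= 1 is paid for by the indicator of the last cell.\<close>
        moreover have "\<bar>indicator B y * a - indicator {..x} y * b\<bar>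
            \<le> \<bar>a - b\<bar> + indicator {x..x + 1 / ?w} y"
          if "b \<le> 1 * 1" "0 \<le> b" "y \<le> x \<Longrightarrow> y \<in> B" "y \<in> B \<Longrightarrow> y \<le> x + 1 / ?w" for a b :: real
          using that by (cases "y \<in> B"; cases "y \<le> x") (auto simp: indicator_def)
        ultimately show ?thesis by blast
      qed
      have "\<bar>(\<Sum>k\<in>S. p n k) - (LINT y|lborel. indicator {..x} y * ?\<phi> y)\<bar>
          = \<bar>LINT y|lborel. indicator B y * ?h n y - indicator {..x} y * ?\<phi> y\<bar>"
        using hB \<phi>A by (simp add: has_bochner_integral_iff)
      also have "\<dots> \<le> (LINT y|lborel. \<bar>indicator B y * ?h n y - indicator {..x} y * ?\<phi> y\<bar>)"
        by (rule integral_abs_bound)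
      also have "\<dots> \<le> (LINT y|lborel. \<bar>?h n y - ?\<phi> y\<bar> + indicator {x..x + 1 / ?w} y)"
        using hB gap_int
        by (intro integral_mono gap integrable_abs Bochner_Integration.integrable_diff
            Bochner_Integration.integrable_add diff_int \<phi>A)
           (auto simp: has_bochner_integral_iff)
      also have "\<dots> = (LINT y|lborel. \<bar>?h n y - ?\<phi> y\<bar>) + 1 / ?w"
        using gap_int diff_int by (simp add: has_bochner_integral_iff)
      also have "\<dots> \<le> \<epsilon>"
        using elim(1) w_small by linarith
      also have "(LINT y|lborel. indicator {..x} y * ?\<phi> y)
          = 1 / sqrt (2 * pi) * (LINT t:{..x}|lborel. exp (- (t\<^sup>2 / 2)))"
        by (simp add: set_lebesgue_integral_def mult.left_commute[of "indicator _ _"] flip: integral_mult_right_zero)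
      finally show "\<bar>(\<Sum>k | 0 \<le> k \<and> k \<le> int n \<and> real_of_int k \<le> \<mu> n + x * ?w. p n k)
          - 1 / sqrt (2 * pi) * (LINT t:{..x}|lborel. exp (- (t\<^sup>2 / 2)))\<bar> \<le> \<epsilon>"
        by (simp only: S_def)
    qed
  qed
qed

end

section \<open>Apery coefficients\<close>

text \<open>The reciprocal of the golden ratio. It arises because (1 - x)^2 (1 + x) - x^3 = 1 - x -
  x^2.\<close>

definition \<kappa> :: real where "\<kappa> = (- 1 + sqrt 5) / 2"

text \<open>With $\psi(x) = 2\ln(1-x) + \ln(1+x) - 3\ln x$, the limit of the logarithmic ratio at $k = xn$, the
  mode is located by $\psi(\kappa) = 0$ and the variance by $1/\tau = -\psi'(\kappa)$.\<close>

definition \<tau> :: real where "\<tau> = (5 - 2 * sqrt 5) / 5"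

text \<open>Crude bounds from (11/5)^2 < 5 < (56/25)^2. They keep indices near \<kappa> n away from
  both ends of the range, so that the reciprocals below are O(1/n).\<close>

lemma \<kappa>_bounds: "3 / 5 < \<kappa>" "\<kappa> < 31 / 50"
proof -
  have "11 / 5 < sqrt (5::real)" "sqrt (5::real) < 56 / 25"
    by (rule real_less_rsqrt real_less_lsqrt; simp add: power2_eq_square)+
  then show "3 / 5 < \<kappa>" "\<kappa> < 31 / 50"
    by (auto simp: \<kappa>_def)
qed

lemma \<kappa>_sq: "\<kappa>\<^sup>2 = 1 - \<kappa>"
  by (simp add: \<kappa>_def power2_eq_square field_simps)

text \<open>Everything reduces through \<kappa>^2 = 1 - \<kappa>: the reciprocals of \<kappa>, 1 +
  \<kappa> and 1 - \<kappa> are 1 + \<kappa>, \<kappa> and 2 + \<kappa>. The last form matches the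
  derivative of \<open>log_ratio\<close>, the linear one suits numerical bounds.\<close>

lemma \<tau>_pos: "\<tau> > 0"
  and inverse_\<tau>: "1 / \<tau> = 7 + 4 * \<kappa>"
  and inverse_\<tau>_eq: "1 / \<tau> = 2 / (1 - \<kappa>) - 1 / (1 + \<kappa>) + 3 / \<kappa>"
proof -
  have "sqrt (5::real) < 5 / 2"
    by (intro real_less_lsqrt) (auto simp: power2_eq_square)
  then show "\<tau> > 0"
    by (simp add: \<tau>_def)
  then show 1: "1 / \<tau> = 7 + 4 * \<kappa>"
    by (simp add: \<tau>_def \<kappa>_def field_simps)
  have k: "\<kappa> \<noteq> 0" "1 + \<kappa> \<noteq> 0" using \<kappa>_bounds by auto
  have "1 / \<kappa> = 1 + \<kappa>" "1 / (1 + \<kappa>) = \<kappa>"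
    using k \<kappa>_sq by (auto simp: field_simps power2_eq_square)
  moreover have "1 / (1 - \<kappa>) = (1 / \<kappa>)\<^sup>2"
    by (simp add: \<kappa>_sq[symmetric] power_divide)
  moreover have "(1 + \<kappa>)\<^sup>2 = 2 + \<kappa>"
    using \<kappa>_sq by (simp add: power2_sum)
  ultimately show "1 / \<tau> = 2 / (1 - \<kappa>) - 1 / (1 + \<kappa>) + 3 / \<kappa>"
    unfolding 1 by (simp add: divide_inverse)
qed

text \<open>The logarithm of $f(n,k+1)/f(n,k)$, extended to real arguments.\<close>

definition log_ratio :: "nat \<Rightarrow> real \<Rightarrow> real" where
  "log_ratio n t = 2 * ln (n - t) + ln (n + t + 1) - 3 * ln (t + 1)"

section \<open>Consecutive coefficients and the slope of their logarithmic ratio\<close>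

lemma apery_coeff_pos: "k \<le> n \<Longrightarrow> apery_coeff n k > 0"
  by (simp add: apery_coeff_def)

text \<open>Two absorption identities, one for each kind of binomial coefficient; the factor (k +
  1)^3 clears all denominators.\<close>

lemma apery_coeff_Suc:
  assumes "k < n"
  shows "(real k + 1) ^ 3 * apery_coeff n (Suc k) = (real n - k)\<^sup>2 * (n + k + 1) * apery_coeff n k"
proof -
  have 1: "(real k + 1) * real (n choose Suc k) = (real n - k) * real (n choose k)"
  proof -
    have "Suc k * (n choose Suc k) = (n - k) * (n choose k)"
      by (simp only: binomial_absorption binomial_absorb_comp)
    from arg_cong[OF this, of real] show ?thesis
      using assms by (simp only: of_nat_mult of_nat_Suc of_nat_diff[OF less_imp_le] add.commute)
  qed
  have 2: "(real k + 1) * real ((n + Suc k) choose Suc k) = (real n + k + 1) * real ((n + k) choose k)"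
  proof -
    have "Suc k * (Suc (n + k) choose Suc k) = Suc (n + k) * ((n + k) choose k)"
      by (rule Suc_times_binomial)
    from arg_cong[OF this, of real] show ?thesis
      by (simp only: of_nat_mult of_nat_Suc of_nat_add add_Suc_right add.commute add.left_commute)
  qed
  have "(real k + 1) ^ 3 * apery_coeff n (Suc k)
      = ((real k + 1) * real (n choose Suc k))\<^sup>2 * ((real k + 1) * real ((n + Suc k) choose Suc k))"
    \<comment> \<open>Pascal's rule is disabled so that the binomials stay in the shape of the
      absorption identities.\<close>
    by (simp add: apery_coeff_def power2_eq_square power3_eq_cube del: binomial_Suc_Suc)
  also have "\<dots> = (real n - k)\<^sup>2 * (n + k + 1) * apery_coeff n k"
    unfolding 1 2 by (simp add: apery_coeff_def power_mult_distrib)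
  finally show ?thesis .
qed

lemma ln_apery_coeff_Suc:
  assumes "k < n"
  shows "ln (apery_coeff n (Suc k)) - ln (apery_coeff n k) = log_ratio n k"
proof -
  have "apery_coeff n (Suc k) > 0" "apery_coeff n k > 0"
    using assms by (auto intro: apery_coeff_pos)
  then have "3 * ln (real k + 1) + ln (apery_coeff n (Suc k))
      = 2 * ln (real n - k) + ln (real n + k + 1) + ln (apery_coeff n k)"
    using arg_cong[OF apery_coeff_Suc[OF assms], of ln] assms
    by (simp add: ln_mult ln_realpow)
  then show ?thesis
    by (simp add: log_ratio_def)
qed

lemma log_ratio_deriv:
  assumes "0 \<le> t" "t < real n"
  shows "(log_ratio n has_real_derivative (- 2 / (n - t) + 1 / (n + t + 1) - 3 / (t + 1))) (at t)"
  unfolding log_ratio_def[abs_def]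
  using assms by (auto intro!: derivative_eq_intros simp: divide_inverse)

text \<open>For 0 <= x <= n - 1 the three terms of the derivative are at most -2/n, 1/n and -3/n, so
  the slope is at most -4/n.\<close>

lemma log_ratio_decrease:
  assumes "0 \<le> t" "t \<le> u" "u \<le> real n - 1"
  shows "log_ratio n u \<le> log_ratio n t - 4 * (u - t) / n"
proof -
  have "log_ratio n u + 4 * u / n \<le> log_ratio n t + 4 * t / n"
  proof (rule DERIV_nonpos_imp_nonincreasing[OF assms(2)])
    fix x assume x: "t \<le> x" "x \<le> u"
    have "2 / real n \<le> 2 / (n - x)" "1 / (n + x + 1) \<le> 1 / n" "3 / real n \<le> 3 / (x + 1)"
      using x assms by (auto intro!: divide_left_mono mult_pos_pos)
    then have "- 2 / (n - x) + 1 / (n + x + 1) - 3 / (x + 1) + 4 / n \<le> 0"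
      by (simp add: field_simps)
    moreover have "((\<lambda>x. log_ratio n x + 4 * x / n) has_real_derivative
        - 2 / (n - x) + 1 / (n + x + 1) - 3 / (x + 1) + 4 / n) (at x)"
      using x assms by (auto intro!: derivative_eq_intros log_ratio_deriv)
    ultimately show "\<exists>y. ((\<lambda>x. log_ratio n x + 4 * x / n) has_real_derivative y) (at x) \<and> y \<le> 0"
      by blast
  qed
  then show ?thesis
    by (simp add: right_diff_distrib diff_divide_distrib)
qed

section \<open>The logarithmic ratio near the mode\<close>

definition mode :: "nat \<Rightarrow> int" where
  "mode n = \<lfloor>\<kappa> * n\<rfloor>"

lemma mode_bounds: "0 \<le> mode n" "mode n \<le> int n" "n > 0 \<Longrightarrow> mode n \<le> int n - 1"
  "real_of_int (mode n) \<le> \<kappa> * n" "\<kappa> * n < mode n + 1"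
proof -
  show "0 \<le> mode n" using \<kappa>_bounds by (simp add: mode_def)
  show le: "real_of_int (mode n) \<le> \<kappa> * n" by (simp add: mode_def)
  show "\<kappa> * n < mode n + 1" by (simp add: mode_def)
  have k: "\<kappa> * n \<le> 1 * real n" using \<kappa>_bounds by (intro mult_right_mono) auto
  then show "mode n \<le> int n" using le by linarith
  show "mode n \<le> int n - 1" if "n > 0"
  proof -
    have "\<kappa> * n < 1 * real n" using \<kappa>_bounds that by (intro mult_strict_right_mono) auto
    then show ?thesis using le by linarith
  qed
qed

text \<open>The powers of \<open>n\<close> cancel, and so do the constants since 2 ln (1 - \<kappa>)
  + ln (1 + \<kappa>) = 3 ln \<kappa>. What remains comes from the two shifts by 1 inside the
  logarithms.\<close>

lemma log_ratio_at_golden: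
  assumes "n > 0"
  shows "\<bar>log_ratio n (\<kappa> * n)\<bar> \<le> 5 / n"
proof -
  have k: "0 < \<kappa>" "\<kappa> < 1" and n: "real n > 0" using \<kappa>_bounds assms by auto
  define a where "a = 1 / (n * (1 + \<kappa>))"
  define b where "b = 1 / (n * \<kappa>)"
  have a: "0 < a" and b: "0 < b" using k n by (auto simp: a_def b_def)
  have "ln (1 - \<kappa>) = 2 * ln \<kappa>"
    using k by (simp add: \<kappa>_sq[symmetric] ln_realpow)
  moreover have "\<kappa> * (1 + \<kappa>) = 1"
    using \<kappa>_sq by (simp add: power2_eq_square algebra_simps)
  then have "ln \<kappa> + ln (1 + \<kappa>) = 0"
    using k ln_mult[of \<kappa> "1 + \<kappa>"] by simp
  moreover have "real n + \<kappa> * n \<noteq> 0"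
    using mult_pos_pos[OF k(1) n] by linarith
  then have "real n - \<kappa> * n = n * (1 - \<kappa>)" "n + \<kappa> * n + 1 = n * (1 + \<kappa>) * (1 + a)"
    "\<kappa> * n + 1 = n * \<kappa> * (1 + b)"
    using k n by (auto simp: a_def b_def field_simps)
  ultimately have eq: "log_ratio n (\<kappa> * n) = ln (1 + a) - 3 * ln (1 + b)"
    unfolding log_ratio_def using k n a b by (simp add: ln_mult)
  have "ln (1 + a) \<le> a" "ln (1 + b) \<le> b" "0 \<le> ln (1 + a)" "0 \<le> ln (1 + b)"
    using a b by (auto intro: ln_add_one_self_le_self)
  moreover have "1 / (1 + \<kappa>) \<le> 5" "3 / \<kappa> \<le> 5"
    using \<kappa>_bounds by (auto simp: field_simps)
  then have "1 / (1 + \<kappa>) / n \<le> 5 / n" "3 / \<kappa> / n \<le> 5 / n"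
    using n by (intro divide_right_mono; simp)+
  then have "a \<le> 5 / n" "3 * b \<le> 5 / n"
    by (simp_all add: a_def b_def mult.commute)
  ultimately show ?thesis
    unfolding eq by linarith
qed

text \<open>Rounding \<kappa> n down moves the argument by less than 1 where the slope is at most
  15/n in absolute value. \<open>mode\<close> is thus a critical point up to O(1/n); it is not
  claimed to be the exact maximiser.\<close>

lemma log_ratio_at_mode:
  assumes "n > 0"
  shows "\<bar>log_ratio n (mode n)\<bar> \<le> 20 / n"
proof -
  let ?m = "real_of_int (mode n)"
  have n: "real n > 0" using assms by simp
  have kn: "\<kappa> * n \<le> (31 / 50) * n" "\<kappa> * n \<ge> (3 / 5) * n"
    using \<kappa>_bounds n by (auto intro: mult_right_mono)
  have "norm (log_ratio n (\<kappa> * n) - log_ratio n ?m) \<le> 15 / n * norm (\<kappa> * n - ?m)"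
  proof (rule field_differentiable_bound[of "{?m..\<kappa> * n}" _ "\<lambda>t. - 2 / (n - t) + 1 / (n + t + 1) - 3 / (t + 1)"])
    fix t assume t: "t \<in> {?m..\<kappa> * n}"
    have t': "0 \<le> t" "t \<le> (31 / 50) * n" "(3 / 5) * n \<le> t + 1"
      using t mode_bounds[of n] kn unfolding atLeastAtMost_iff by linarith+
    then show "(log_ratio n has_field_derivative - 2 / (n - t) + 1 / (n + t + 1) - 3 / (t + 1))
        (at t within {?m..\<kappa> * n})"
      using n by (intro has_field_derivative_at_within[OF log_ratio_deriv]) auto
    \<comment> \<open>Here n - t >= (19/50) n; the smaller 2/9 makes the quotient exactly 9/n. The
      three bounds add up to (9 + 1 + 5)/n = 15/n.\<close>
    have "2 / (n - t) \<le> 2 / (2 / 9 * n)" "1 / (n + t + 1) \<le> 1 / n" "3 / (t + 1) \<le> 3 / (3 / 5 * n)"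
      by (rule frac_le; use t' n in linarith)+
    then have "2 / (n - t) \<le> 9 * (1 / n)" "1 / (n + t + 1) \<le> 1 / n" "3 / (t + 1) \<le> 5 * (1 / n)"
      by simp_all
    moreover have "0 \<le> 2 / (n - t)" "0 \<le> 1 / (n + t + 1)" "0 \<le> 3 / (t + 1)"
      using t' n by auto
    moreover have "15 / n = 15 * (1 / real n)"
      by simp
    ultimately show "norm (- 2 / (n - t) + 1 / (n + t + 1) - 3 / (t + 1)) \<le> 15 / n"
      unfolding real_norm_def minus_divide_left[symmetric] by linarith
  qed (use mode_bounds in auto)
  also have "\<dots> \<le> 15 / n * 1"
    using mode_bounds[of n] n by (intro mult_left_mono) auto
  finally have "\<bar>log_ratio n (\<kappa> * n) - log_ratio n ?m\<bar> \<le> 15 / n"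
    by simp
  moreover have "15 / n + 5 / n = 20 / real n"
    by simp
  ultimately show ?thesis
    using log_ratio_at_golden[OF assms] by linarith
qed

section \<open>The telescoped logarithmic profile and its global bound\<close>

definition log_profile :: "nat \<Rightarrow> int \<Rightarrow> real" where
  "log_profile n j = ln (apery_coeff n (nat (mode n + j))) - ln (apery_coeff n (nat (mode n)))"

lemma log_profile_0 [simp]: "log_profile n 0 = 0"
  by (simp add: log_profile_def)

lemma log_profile_step:
  assumes "0 \<le> mode n + j" "mode n + j < int n"
  shows "log_profile n (j + 1) - log_profile n j = log_ratio n (mode n + j)"
proof -
  have "nat (mode n + (j + 1)) = Suc (nat (mode n + j))" "nat (mode n + j) < n"
    using assms by auto
  then show ?thesis
    using ln_apery_coeff_Suc[of "nat (mode n + j)" n] assms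
    by (simp add: log_profile_def)
qed

text \<open>Adding 2 j^2/n cancels the slope -4/n, so \<open>G\<close> grows by at most 22/n per
  step away from 0: 20/n from the ratio at the mode and 2/n from the discrete square. At most
  \<open>n\<close> steps give the constant 22.\<close>

lemma log_profile_le:
  assumes "n > 0" "0 \<le> mode n + j" "mode n + j \<le> int n"
  shows "log_profile n j \<le> 22 - 2 * (real_of_int j)\<^sup>2 / n"
proof -
  define G where "G = (\<lambda>j. log_profile n j + 2 * (real_of_int j)\<^sup>2 / n)"
  have n: "real n > 0" using assms by simp
  note lm = log_ratio_at_mode[OF assms(1)]
  have sq: "2 * (real_of_int (i + 1))\<^sup>2 / n = 2 * (real_of_int i)\<^sup>2 / n + 4 * real_of_int i / n + 2 / n" for i
    by (simp add: power2_sum add_divide_distrib algebra_simps)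
  have up: "G i \<le> 22 * real_of_int i / n" if "0 \<le> i" "mode n + i \<le> int n" for i
    using that
  proof (induction i rule: int_ge_induct)
    case base
    then show ?case by (simp add: G_def)
  next
    case (step i)
    have "log_ratio n (real_of_int (mode n) + i) \<le> log_ratio n (mode n) - 4 * (real_of_int (mode n) + i - mode n) / n"
      using step mode_bounds[of n] by (intro log_ratio_decrease) linarith+
    then have "log_ratio n (mode n + i) \<le> 20 / n - 4 * real_of_int i / n"
      using lm by simp
    moreover have "log_profile n (i + 1) - log_profile n i = log_ratio n (mode n + i)"
      using step mode_bounds[of n] by (intro log_profile_step) auto
    moreover have "G i \<le> 22 * real_of_int i / n"
      using step by simp
    moreover have "22 * real_of_int (i + 1) / n = 22 * real_of_int i / n + 20 / n + 2 / n"
      by (simp add: distrib_left add_divide_distrib)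
    ultimately show ?case
      using sq[of i] unfolding G_def by linarith
  qed
  have down: "G i \<le> 22 * real_of_int (- i) / n" if "i \<le> 0" "0 \<le> mode n + i" for i
    using that
  proof (induction i rule: int_le_induct)
    case base
    then show ?case by (simp add: G_def)
  next
    case (step i)
    have "log_ratio n (mode n)
        \<le> log_ratio n (real_of_int (mode n) + (i - 1)) - 4 * (mode n - (real_of_int (mode n) + (i - 1))) / n"
      using step mode_bounds[of n] assms(1) by (intro log_ratio_decrease) linarith+
    then have "log_ratio n (mode n + (i - 1)) \<ge> - 20 / n - 4 * real_of_int (i - 1) / n"
      using lm by (simp add: minus_divide_left[symmetric] diff_divide_distrib)
    moreover have "log_profile n (i - 1 + 1) - log_profile n (i - 1) = log_ratio n (mode n + (i - 1))"
      using step mode_bounds[of n] assms(1) by (intro log_profile_step) auto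
    moreover have "G i \<le> 22 * real_of_int (- i) / n"
      using step by simp
    moreover have "22 * real_of_int (- (i - 1)) / n = 22 * real_of_int (- i) / n + 20 / n + 2 / n"
      by (simp add: right_diff_distrib diff_divide_distrib)
    \<comment> \<open>Downwards the discrete square helps and the true increment is 18/n; this fact
      lets it be rounded up to 22/n.\<close>
    moreover have "2 / real n \<ge> 0" by simp
    ultimately show ?case
      using sq[of "i - 1"] unfolding G_def diff_add_cancel by linarith
  qed
  have "G j \<le> 22 * \<bar>real_of_int j\<bar> / n"
    using up[of j] down[of j] assms by (cases "j \<ge> 0") auto
  also have "\<bar>real_of_int j\<bar> \<le> n"
    using assms mode_bounds[of n] by linarith
  then have "22 * \<bar>real_of_int j\<bar> / n \<le> 22"
    using n by (simp add: field_simps)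
  finally show ?thesis
    by (simp add: G_def)
qed

section \<open>Quadratic approximation of the logarithmic profile\<close>

lemma inverse_diff_bound:
  fixes x y :: real
  assumes "a > 0" "b > 0" "a \<le> x" "b \<le> y"
  shows "\<bar>1 / x - 1 / y\<bar> \<le> \<bar>x - y\<bar> / (a * b)"
proof -
  have "\<bar>1 / x - 1 / y\<bar> = \<bar>x - y\<bar> / (x * y)"
    using assms by (simp add: diff_frac_eq abs_divide abs_mult abs_minus_commute)
  also have "\<dots> \<le> \<bar>x - y\<bar> / (a * b)"
    using assms by (intro divide_left_mono mult_mono mult_pos_pos) auto
  finally show ?thesis .
qed

text \<open>Each reciprocal is compared with its value at \<kappa> n, where they combine to
  -1/(\<tau> n). The +1 in the bound by \<open>d\<close> covers the shifts in t + 1 and n + t + 1,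
  and d <= n/10 confines t/n to [1/2, 18/25]. The weighted errors 2 * 10 + 1 + 3 * 10/3 give
  31.\<close>

lemma log_ratio_deriv_approx:
  fixes d t :: real
  assumes "n > 0" "\<bar>t - \<kappa> * n\<bar> + 1 \<le> d" "d \<le> n / 10"
  shows "\<bar>- 2 / (n - t) + 1 / (n + t + 1) - 3 / (t + 1) + 1 / (\<tau> * n)\<bar> \<le> 31 * d / (real n)\<^sup>2"
proof -
  have n: "real n > 0" and d: "d > 0" using assms by auto
  have kn: "\<kappa> * n \<le> (31 / 50) * n" "\<kappa> * n \<ge> (3 / 5) * n"
    using \<kappa>_bounds n by (auto intro: mult_right_mono)
  have t: "t \<le> (18 / 25) * n" "t \<ge> (1 / 2) * n"
    using assms kn by linarith+
  have "\<bar>1 / (n - t) - 1 / (n - \<kappa> * n)\<bar> \<le> \<bar>(n - t) - (n - \<kappa> * n)\<bar> / (((7 / 25) * n) * ((19 / 50) * n))"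
    using t kn n by (intro inverse_diff_bound) auto
  also have "\<dots> \<le> d / ((1 / 10) * (real n)\<^sup>2)"
    using assms(2) n by (intro frac_le) (auto simp: power2_eq_square)
  finally have 1: "\<bar>1 / (n - t) - 1 / (n - \<kappa> * n)\<bar> \<le> 10 * (d / (real n)\<^sup>2)"
    by (simp add: mult.commute)
  have "\<bar>1 / (n + t + 1) - 1 / (n + \<kappa> * n)\<bar> \<le> \<bar>(n + t + 1) - (n + \<kappa> * n)\<bar> / (real n * real n)"
    using t kn n by (intro inverse_diff_bound) auto
  also have "\<dots> \<le> d / (real n)\<^sup>2"
    using assms(2) n by (intro frac_le) (auto simp: power2_eq_square)
  finally have 2: "\<bar>1 / (n + t + 1) - 1 / (n + \<kappa> * n)\<bar> \<le> d / (real n)\<^sup>2" .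
  have "\<bar>1 / (t + 1) - 1 / (\<kappa> * n)\<bar> \<le> \<bar>(t + 1) - \<kappa> * n\<bar> / (((1 / 2) * n) * ((3 / 5) * n))"
    using t kn n by (intro inverse_diff_bound) auto
  also have "\<dots> \<le> d / ((3 / 10) * (real n)\<^sup>2)"
    using assms(2) n by (intro frac_le) (auto simp: power2_eq_square)
  finally have 3: "\<bar>1 / (t + 1) - 1 / (\<kappa> * n)\<bar> \<le> 10 / 3 * (d / (real n)\<^sup>2)"
    by (simp add: mult.commute)
  have "1 / (\<tau> * n) = (2 / (1 - \<kappa>) - 1 / (1 + \<kappa>) + 3 / \<kappa>) / n"
    by (simp add: inverse_\<tau>_eq[symmetric])
  also have "\<dots> = 2 * (1 / (n - \<kappa> * n)) - 1 / (n + \<kappa> * n) + 3 * (1 / (\<kappa> * n))"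
    by (simp add: add_divide_distrib diff_divide_distrib algebra_simps)
  finally have "- 2 / (n - t) + 1 / (n + t + 1) - 3 / (t + 1) + 1 / (\<tau> * n)
      = - 2 * (1 / (n - t) - 1 / (n - \<kappa> * n)) + (1 / (n + t + 1) - 1 / (n + \<kappa> * n))
        - 3 * (1 / (t + 1) - 1 / (\<kappa> * n))"
    by (simp add: algebra_simps)
  moreover have "\<bar>- 2 * x + y - 3 * z\<bar> \<le> 31 * D"
    if "\<bar>x\<bar> \<le> 10 * D" "\<bar>y\<bar> \<le> D" "\<bar>z\<bar> \<le> 10 / 3 * D" for x y z D :: real
    using that by linarith
  from this[OF 1 2 3] have "\<bar>- 2 * (1 / (n - t) - 1 / (n - \<kappa> * n)) + (1 / (n + t + 1) - 1 / (n + \<kappa> * n))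
        - 3 * (1 / (t + 1) - 1 / (\<kappa> * n))\<bar> \<le> 31 * d / (real n)\<^sup>2"
    by simp
  ultimately show ?thesis
    by (simp only:)
qed

text \<open>The mean value theorem for \<open>log_ratio\<close> with its linear part removed,
  started at the mode. Of the margin 2 in the bound by \<open>N\<close>, one unit covers the
  rounding of \<kappa> n and one the shift in \<open>log_ratio_deriv_approx\<close>.\<close>

lemma log_ratio_approx:
  assumes "n > 0" "\<bar>real_of_int j\<bar> + 2 \<le> N" "N \<le> n / 10"
  shows "\<bar>log_ratio n (mode n + j) + real_of_int j / (\<tau> * n)\<bar> \<le> 20 / n + 31 * N\<^sup>2 / (real n)\<^sup>2"
proof -
  let ?m = "real_of_int (mode n)"
  let ?I = "{min ?m (?m + j)..max ?m (?m + j)}"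
  have n: "real n > 0" using assms by simp
  have kn: "\<kappa> * n \<le> (31 / 50) * n" "\<kappa> * n \<ge> (3 / 5) * n"
    using \<kappa>_bounds n by (auto intro: mult_right_mono)
  have "norm ((log_ratio n (?m + j) + (?m + j) / (\<tau> * n)) - (log_ratio n ?m + ?m / (\<tau> * n)))
      \<le> 31 * N / (real n)\<^sup>2 * norm ((?m + j) - ?m)"
  proof (rule field_differentiable_bound[of ?I "\<lambda>t. log_ratio n t + t / (\<tau> * n)"
        "\<lambda>t. - 2 / (n - t) + 1 / (n + t + 1) - 3 / (t + 1) + 1 / (\<tau> * n)"])
    fix t assume t: "t \<in> ?I"
    then have tk: "\<bar>t - \<kappa> * n\<bar> + 1 \<le> N"
      using mode_bounds(4,5)[of n] assms(2) by (auto simp: min_def max_def split: if_splits)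
    then show "norm (- 2 / (n - t) + 1 / (n + t + 1) - 3 / (t + 1) + 1 / (\<tau> * n)) \<le> 31 * N / (real n)\<^sup>2"
      unfolding real_norm_def using assms by (intro log_ratio_deriv_approx)
    have "0 \<le> t" "t < n"
      using tk kn assms(3) n by linarith+
    then show "((\<lambda>t. log_ratio n t + t / (\<tau> * n)) has_field_derivative
        - 2 / (n - t) + 1 / (n + t + 1) - 3 / (t + 1) + 1 / (\<tau> * n)) (at t within ?I)"
      by (intro DERIV_add has_field_derivative_at_within[OF log_ratio_deriv] DERIV_cdivide DERIV_ident)
  qed auto
  also have "\<dots> \<le> 31 * N / (real n)\<^sup>2 * N"
    using assms by (intro mult_left_mono) auto
  also have "\<dots> = 31 * N\<^sup>2 / (real n)\<^sup>2"
    by (simp add: power2_eq_square)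
  finally have "\<bar>(log_ratio n (?m + j) + real_of_int j / (\<tau> * n)) - log_ratio n ?m\<bar> \<le> 31 * N\<^sup>2 / (real n)\<^sup>2"
    by (simp add: add_divide_distrib algebra_simps)
  then show ?thesis
    using log_ratio_at_mode[OF assms(1)] by simp
qed

text \<open>Telescoping, with error \<open>K\<close> per step. The constant 25 is 20 from
  \<open>log_ratio_approx\<close> plus 5 for the term 1/(2 \<tau> n) left over when j^2 is
  differenced.\<close>

lemma log_profile_approx:
  assumes "n > 0" "\<bar>real_of_int j\<bar> + 2 \<le> N" "N \<le> n / 10"
  shows "\<bar>log_profile n j + (real_of_int j)\<^sup>2 / (2 * \<tau> * n)\<bar> \<le> \<bar>real_of_int j\<bar> * (25 / n + 31 * N\<^sup>2 / (real n)\<^sup>2)"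
proof -
  define H where "H = (\<lambda>j. log_profile n j + (real_of_int j)\<^sup>2 / (2 * \<tau> * n))"
  define K where "K = 25 / n + 31 * N\<^sup>2 / (real n)\<^sup>2"
  have n: "real n > 0" using assms by simp
  have kn: "\<kappa> * n \<le> (31 / 50) * n" "\<kappa> * n \<ge> (3 / 5) * n"
    using \<kappa>_bounds n by (auto intro: mult_right_mono)
  have increment: "\<bar>H (i + 1) - H i\<bar> \<le> K" if "\<bar>real_of_int i\<bar> + 2 \<le> N" for i
  proof -
    have "real_of_int 0 \<le> real_of_int (mode n + i)" "real_of_int (mode n + i) < real_of_int (int n)"
      using that mode_bounds[of n] kn assms(3) n by (simp_all only: of_int_add of_int_of_nat_eq of_int_0)
    then have "0 \<le> mode n + i" "mode n + i < int n"
      by (simp_all only: of_int_le_iff of_int_less_iff)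
    note log_profile_step[OF this]
    moreover have "(real_of_int (i + 1))\<^sup>2 / (2 * \<tau> * n) - (real_of_int i)\<^sup>2 / (2 * \<tau> * n)
        = real_of_int i / (\<tau> * n) + 1 / (2 * \<tau> * n)"
      using \<tau>_pos n by (simp add: power2_sum field_simps)
    moreover have "\<bar>log_ratio n (mode n + i) + real_of_int i / (\<tau> * n)\<bar> \<le> 20 / n + 31 * N\<^sup>2 / (real n)\<^sup>2"
      by (intro log_ratio_approx assms that)
    moreover have "(1 / \<tau>) / 2 \<le> 5"
      using \<kappa>_bounds by (simp add: inverse_\<tau>)
    then have "(1 / \<tau>) / 2 / n \<le> 5 / n"
      by (rule divide_right_mono) simp
    then have "1 / (2 * \<tau> * n) \<le> 5 / n"
      by simp
    moreover have "0 \<le> 1 / (2 * \<tau> * n)"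
      using \<tau>_pos n by simp
    moreover have "K = 20 / n + 5 / n + 31 * N\<^sup>2 / (real n)\<^sup>2"
      by (simp add: K_def)
    ultimately show ?thesis
      unfolding H_def by linarith
  qed
  have up: "\<bar>H i\<bar> \<le> real_of_int i * K" if "0 \<le> i" "\<bar>real_of_int i\<bar> + 2 \<le> N" for i
    using that
  proof (induction i rule: int_ge_induct)
    case (step i)
    then have "\<bar>H (i + 1) - H i\<bar> \<le> K" "\<bar>H i\<bar> \<le> real_of_int i * K"
      using increment[of i] by auto
    then show ?case
      by (simp add: distrib_right)
  qed (simp add: H_def)
  have down: "\<bar>H i\<bar> \<le> real_of_int (- i) * K" if "i \<le> 0" "\<bar>real_of_int i\<bar> + 2 \<le> N" for i
    using that
  proof (induction i rule: int_le_induct)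
    case (step i)
    then have "\<bar>H i - H (i - 1)\<bar> \<le> K" "\<bar>H i\<bar> \<le> real_of_int (- i) * K"
      using increment[of "i - 1"] by auto
    then show ?case
      by (simp add: left_diff_distrib)
  qed (simp add: H_def)
  have "\<bar>H j\<bar> \<le> \<bar>real_of_int j\<bar> * K"
    using up[of j] down[of j] assms(2) by (cases "j \<ge> 0") auto
  then show ?thesis
    by (simp add: H_def K_def)
qed

text \<open>Factor out exp(-q) <= 1. For the lower side, 1 - exp y <= -y <= \<delta> <= exp \<delta>
  - 1 with y = x + q.\<close>

lemma exp_diff_bound:
  fixes x q \<delta> :: real
  assumes "\<bar>x + q\<bar> \<le> \<delta>" "q \<ge> 0"
  shows "\<bar>exp x - exp (- q)\<bar> \<le> exp \<delta> - 1"
proof -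
  have "exp x - exp (- q) = exp (- q) * (exp (x + q) - 1)"
    by (simp add: right_diff_distrib mult_exp_exp)
  then have "\<bar>exp x - exp (- q)\<bar> = exp (- q) * \<bar>exp (x + q) - 1\<bar>"
    by (simp add: abs_mult)
  also have "\<dots> \<le> 1 * \<bar>exp (x + q) - 1\<bar>"
    using assms(2) by (intro mult_right_mono) auto
  also have "\<bar>exp (x + q) - 1\<bar> \<le> exp \<delta> - 1"
  proof -
    have "exp (x + q) \<le> exp \<delta>" using assms by simp
    moreover have "1 + (x + q) \<le> exp (x + q)" "1 + \<delta> \<le> exp \<delta>"
      by (rule exp_ge_add_one_self)+
    ultimately show ?thesis using assms(1) by linarith
  qed
  finally show ?thesis by simp
qed

section \<open>The Apery array has a Gaussian profile\<close>

lemma apery_total_pos: "(\<Sum>j=0..n. apery_coeff n j) > 0"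
  by (intro sum_pos) (auto intro: apery_coeff_pos)

lemma normalized_ratio:
  assumes "0 \<le> mode n + j" "mode n + j \<le> int n"
  shows "normalized apery_coeff n (mode n + j) / normalized apery_coeff n (mode n) = exp (log_profile n j)"
proof -
  have "apery_coeff n (nat (mode n + j)) > 0" "apery_coeff n (nat (mode n)) > 0"
    using assms mode_bounds[of n] by (auto intro!: apery_coeff_pos)
  then show ?thesis
    using assms mode_bounds[of n] apery_total_pos[of n]
    by (simp add: normalized_def log_profile_def exp_diff)
qed

lemma sum_int_nat: "(\<Sum>k=0..int n. f k) = (\<Sum>k=0..n. f (int k))"
  using sum.atLeast_int_atMost_int_shift[of f 0 n] by simp

text \<open>\<open>exp 22\<close> and 2 are the constants of \<open>log_profile_le\<close>; outside
  the support the domination is trivial. \<open>near\<close> comes from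
  \<open>log_profile_approx\<close> by exponentiating.\<close>

interpretation apery: gaussian_profile "normalized apery_coeff" mode \<tau> "exp 22" 2
proof
  show "\<tau> > 0" by (rule \<tau>_pos)
  show "(0::real) < 2" by simp
  show "normalized apery_coeff n k \<ge> 0" for n k
    using apery_total_pos[of n] by (auto simp: normalized_def apery_coeff_def)
  show "normalized apery_coeff n k = 0" if "k \<notin> {0..int n}" for n k
    using that by (auto simp: normalized_def)
  show "(\<Sum>k=0..int n. normalized apery_coeff n k) = 1" for n
    using apery_total_pos[of n] by (simp add: sum_int_nat normalized_def flip: sum_divide_distrib)
  show "normalized apery_coeff n (mode n) > 0" for n
    using apery_total_pos[of n] mode_bounds[of n] apery_coeff_pos[of "nat (mode n)" n]
    by (simp add: normalized_def)
  show "normalized apery_coeff n (mode n + j) / normalized apery_coeff n (mode n)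
      \<le> exp 22 * exp (- 2 * (real_of_int j)\<^sup>2 / n)" if "n > 0" for n j
  proof (cases "0 \<le> mode n + j \<and> mode n + j \<le> int n")
    case True
    then show ?thesis
      using log_profile_le[OF that, of j] by (simp add: normalized_ratio mult_exp_exp)
  next
    case False
    then show ?thesis by (auto simp: normalized_def)
  qed
  show "\<forall>\<^sub>F n in sequentially. \<forall>j. \<bar>real_of_int j\<bar> \<le> M * sqrt n \<longrightarrow>
      \<bar>normalized apery_coeff n (mode n + j) / normalized apery_coeff n (mode n)
        - exp (- ((real_of_int j)\<^sup>2 / (2 * \<tau> * n)))\<bar> \<le> \<epsilon>" if "\<epsilon> > 0" for M \<epsilon>
  proof -
    \<comment> \<open>Replaces \<open>M\<close>, whose sign is arbitrary, by a positive window
      constant, as the asymptotic estimates require.\<close>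
    define L where "L = \<bar>M\<bar> + 1"
    have L: "L > 0" by (simp add: L_def)
    \<comment> \<open>The error of \<open>log_profile_approx\<close> for N = L sqrt n + 2 and |j| <=
      L sqrt n; it is O(1/sqrt n).\<close>
    define \<delta> where "\<delta> = (\<lambda>n::nat. L * sqrt n * (25 / n + 31 * (L * sqrt n + 2)\<^sup>2 / (real n)\<^sup>2))"
    have "\<delta> \<longlonglongrightarrow> 0"
      unfolding \<delta>_def using L by real_asymp
    then have "(\<lambda>n. exp (\<delta> n) - 1) \<longlonglongrightarrow> exp 0 - 1"
      by (intro tendsto_intros)
    then have ev1: "\<forall>\<^sub>F n in sequentially. exp (\<delta> n) - 1 < \<epsilon>"
      using that by (intro order_tendstoD) auto
    have ev2: "\<forall>\<^sub>F n in sequentially. L * sqrt n + 2 \<le> real n / 10"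
      using L by real_asymp
    from ev1 ev2 eventually_gt_at_top[of 0] show ?thesis
    proof eventually_elim
      case (elim n)
      show ?case
      proof (intro allI impI)
        fix j :: int assume "\<bar>real_of_int j\<bar> \<le> M * sqrt n"
        also have "M * sqrt n \<le> L * sqrt n"
          by (intro mult_right_mono) (auto simp: L_def)
        finally have j: "\<bar>real_of_int j\<bar> \<le> L * sqrt n" .
        have n: "real n > 0" using elim by simp
        have kn: "\<kappa> * n \<le> (31 / 50) * n" "\<kappa> * n \<ge> (3 / 5) * n"
          using \<kappa>_bounds n by (auto intro: mult_right_mono)
        have "real_of_int 0 \<le> real_of_int (mode n + j)" "real_of_int (mode n + j) \<le> real_of_int (int n)"
          using j elim(2) kn mode_bounds[of n] n
          by (simp_all only: of_int_add of_int_of_nat_eq of_int_0)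
        then have range: "0 \<le> mode n + j" "mode n + j \<le> int n"
          by (simp_all only: of_int_le_iff)
        have "\<bar>log_profile n j + (real_of_int j)\<^sup>2 / (2 * \<tau> * n)\<bar>
            \<le> \<bar>real_of_int j\<bar> * (25 / n + 31 * (L * sqrt n + 2)\<^sup>2 / (real n)\<^sup>2)"
          using j elim by (intro log_profile_approx) auto
        also have "\<dots> \<le> \<delta> n"
          unfolding \<delta>_def using j by (intro mult_right_mono) auto
        finally have "\<bar>exp (log_profile n j) - exp (- ((real_of_int j)\<^sup>2 / (2 * \<tau> * n)))\<bar> \<le> exp (\<delta> n) - 1"
          using \<tau>_pos by (intro exp_diff_bound) auto
        then show "\<bar>normalized apery_coeff n (mode n + j) / normalized apery_coeff n (mode n)
            - exp (- ((real_of_int j)\<^sup>2 / (2 * \<tau> * n)))\<bar> \<le> \<epsilon>"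
          using elim(1) by (simp only: normalized_ratio[OF range])
      qed
    qed
  qed
qed

section \<open>Mean and variance from the polynomial, and their asymptotics\<close>

lemma poly_apery_poly_1:
  shows "poly (apery_poly n) 1 = (\<Sum>k=0..n. apery_coeff n k)"
    and "poly (pderiv (apery_poly n)) 1 = (\<Sum>k=0..n. real k * apery_coeff n k)"
    and "poly (pderiv (pderiv (apery_poly n))) 1 = (\<Sum>k=0..n. (real k)\<^sup>2 * apery_coeff n k - real k * apery_coeff n k)"
proof -
  show "poly (apery_poly n) 1 = (\<Sum>k=0..n. apery_coeff n k)"
    by (simp add: apery_poly_def poly_sum poly_monom)
  have 1: "pderiv (apery_poly n) = (\<Sum>k=0..n. monom (real k * apery_coeff n k) (k - 1))"
    by (simp add: apery_poly_def higher_pderiv_sum[of 1, simplified] pderiv_monom)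
  then show "poly (pderiv (apery_poly n)) 1 = (\<Sum>k=0..n. real k * apery_coeff n k)"
    by (simp add: poly_sum poly_monom)
  \<comment> \<open>At \<open>k = 0\<close> the subtraction truncates to 0, but the factor
    \<open>real k\<close> vanishes there.\<close>
  have "real (k - 1) * (real k * c) = (real k)\<^sup>2 * c - real k * c" for k c
    by (cases k) (simp_all add: power2_eq_square algebra_simps)
  then show "poly (pderiv (pderiv (apery_poly n))) 1
      = (\<Sum>k=0..n. (real k)\<^sup>2 * apery_coeff n k - real k * apery_coeff n k)"
    by (simp add: 1 higher_pderiv_sum[of 1, simplified] pderiv_monom poly_sum poly_monom)
qed

lemma apery_mean_eq: "apery_mean n = apery.\<mu> n"
  by (simp add: apery_mean_def apery.\<mu>_def poly_apery_poly_1 sum_int_nat normalized_def sum_divide_distrib)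

text \<open>The second derivative at 1 yields the factorial moment of k (k - 1); adding the mean
  restores the second moment.\<close>

lemma apery_var_eq: "apery_var n = apery.v n"
proof -
  have "(\<Sum>k=0..int n. (real_of_int k)\<^sup>2 * normalized apery_coeff n k)
      = (\<Sum>k=0..n. (real k)\<^sup>2 * apery_coeff n k) / (\<Sum>k=0..n. apery_coeff n k)"
    by (simp add: sum_int_nat normalized_def sum_divide_distrib)
  then show ?thesis
    unfolding apery_var_def apery.v_def apery_mean_eq[symmetric]
    by (simp add: apery_mean_def poly_apery_poly_1 sum_subtractf diff_divide_distrib)
qed

lemma mode_ratio_tendsto: "(\<lambda>n. real_of_int (mode n) / n) \<longlonglongrightarrow> \<kappa>"
  unfolding mode_def using \<kappa>_bounds by real_asymp

text \<open>The mean differs from \<open>mode n\<close> by o(sqrt n), which vanishes after division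
  by \<open>n\<close>.\<close>

lemma apery_mean_tendsto: "(\<lambda>n. apery_mean n / n) \<longlonglongrightarrow> \<kappa>"
proof -
  have "(\<lambda>n. (apery.\<mu> n - mode n) / sqrt n * (1 / sqrt n) + mode n / n) \<longlonglongrightarrow> 0 * 0 + \<kappa>"
    by (intro tendsto_intros apery.mean_centre_tendsto mode_ratio_tendsto) real_asymp
  moreover have "(apery.\<mu> n - mode n) / sqrt n * (1 / sqrt n) + mode n / n = apery_mean n / n" for n
    by (simp add: apery_mean_eq diff_divide_distrib)
  ultimately show ?thesis by simp
qed

theorem theorem3p2:
  shows "local_limit apery_coeff apery_mean apery_var \<and>
         central_limit apery_coeff apery_mean apery_var \<and>
         apery_mean \<sim>[at_top] (\<lambda>n. (- 1 + sqrt 5) / 2 * real n) \<and>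
         apery_var \<sim>[at_top] (\<lambda>n. (5 - 2 * sqrt 5) / 5 * real n)"
proof (intro conjI)
  have eq: "apery_mean = apery.\<mu>" "apery_var = apery.v"
    by (auto simp: apery_mean_eq apery_var_eq)
  show "local_limit apery_coeff apery_mean apery_var"
    unfolding local_limit_def eq by (intro sup_tendsto_zero apery.local_uniform)
  show "central_limit apery_coeff apery_mean apery_var"
    unfolding central_limit_def eq by (intro sup_tendsto_zero apery.cdf_uniform)
  have "(\<lambda>n. apery_mean n / n / \<kappa>) \<longlonglongrightarrow> \<kappa> / \<kappa>"
    using \<kappa>_bounds by (intro tendsto_intros apery_mean_tendsto) auto
  then show "apery_mean \<sim>[at_top] (\<lambda>n. (- 1 + sqrt 5) / 2 * real n)"
    using \<kappa>_bounds unfolding \<kappa>_def[symmetric] by (intro asymp_equivI') (simp add: mult.commute)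
  have "(\<lambda>n. apery_var n / n / \<tau>) \<longlonglongrightarrow> \<tau> / \<tau>"
    using \<tau>_pos unfolding eq by (intro tendsto_intros apery.var_tendsto) auto
  then show "apery_var \<sim>[at_top] (\<lambda>n. (5 - 2 * sqrt 5) / 5 * real n)"
    using \<tau>_pos unfolding \<tau>_def[symmetric] by (intro asymp_equivI') (simp add: mult.commute)
qed

end
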